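(* Fix an integer $K\ge 2$ and constants $a,b>0$ and $s\in[0,1]$, and let $(G_1,G_2,\ldots,G_K)\sim \mathrm{CSBM}(n,a\frac{\log n}{n},b\frac{\log n}{n},s)$, with latent permutations $\boldsymbol{\pi^*}=(\pi^*_{12},\ldots,\pi^*_{1K})$. Suppose that $$s\left(1-(1-s)^{K-1}\right)\frac{a+b}{2}>1 .$$ Then exact graph matching is possible: there exists an estimator $\widehat{\boldsymbol\pi}=\widehat{\boldsymbol\pi}(G_1,\ldots,G_K)=(\widehat\pi_{12},\ldots,\widehat\pi_{1K})$ such that $$\lim_{n\to\infty}\mathbb{P}\left(\widehat{\boldsymbol\pi}(G_1,\ldots,G_K)=\boldsymbol{\pi^*}\right)=1 .$$
   Context: SBM: $G\sim\mathrm{SBM}(n,p,q)$ has vertex set $[n]$; labels $\sigma^*(i)\in\{+1,-1\}$, $i\in[n]$, are i.i.d. uniform; given $\boldsymbol{\sigma^*}$, each pair of distinct vertices $\{i,j\}$ is independently an edge with probability $p$ if $\sigma^*(i)=\sigma^*(j)$ and with probability $q$ otherwise. Correlated SBMs: $(G_1,\ldots,G_K)\sim\mathrm{CSBM}(n,p,q,s)$ is generated as follows. Sample a parent graph $G_0\sim\mathrm{SBM}(n,p,q)$. Given $G_0$, form $G_1',\ldots,G_K'$ independently, each by keeping every edge of $G_0$ independently with probability $s$ (non-edges stay non-edges). Let $\pi^*_{12},\ldots,\pi^*_{1K}$ be i.i.d. uniformly random permutations of $[n]$, independent of everything else. Set $G_1:=G_1'$ and, for $i\ge 2$, let $G_i:=\pi^*_{1i}(G_i')$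 be $G_i'$ with each vertex $j$ relabeled $\pi^*_{1i}(j)$. Only $G_1,\ldots,G_K$ are observed. An estimator is a function of the observed graphs (it may depend on $n,a,b,s,K$). Here $n$ is large enough that $a\frac{\log n}{n},b\frac{\log n}{n}\in[0,1]$, and $K,a,b,s$ do not depend on $n$. *)

theory Defs
  imports "HOL-Probability.Probability" "HOL-Combinatorics.Permutations"
begin

text \<open>A simple graph on the vertex set \<open>[n] = {1..n}\<close> is represented by its set of edges,
  a subset of \<open>vertex_pairs n\<close>.\<close>

type_synonym graph = "nat set set"

definition vertex_pairs :: "nat \<Rightarrow> nat set set" where
  "vertex_pairs n = {e. e \<subseteq> {1..n} \<and> card e = 2}"

text \<open>\<^const>\<open>bernoulli_pmf\<close> truncates its parameter to \<open>[0,1]\<close>.\<close>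

definition random_subset :: "'a set \<Rightarrow> ('a \<Rightarrow> real) \<Rightarrow> 'a set pmf" where
  "random_subset A w =
     map_pmf (\<lambda>f. {e \<in> A. f e}) (Pi_pmf A False (\<lambda>e. bernoulli_pmf (w e)))"

definition labels_pmf :: "nat \<Rightarrow> (nat \<Rightarrow> int) pmf" where
  "labels_pmf n = Pi_pmf {1..n} 0 (\<lambda>_. pmf_of_set {1, -1})"

definition sbm :: "nat \<Rightarrow> real \<Rightarrow> real \<Rightarrow> graph pmf" where
  "sbm n p q = do {
     \<sigma> \<leftarrow> labels_pmf n;
     random_subset (vertex_pairs n) (\<lambda>e. if \<forall>i\<in>e. \<forall>j\<in>e. \<sigma> i = \<sigma> j then p else q)
   }"

definition relabel :: "(nat \<Rightarrow> nat) \<Rightarrow> graph \<Rightarrow> graph" where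
  "relabel \<pi> G = (\<lambda>e. \<pi> ` e) ` G"

text \<open>Joint law of the observed graphs \<open>G\<^sub>1, \<dots>, G\<^sub>K\<close> and the latent permutations
  \<open>\<pi>\<^sub>1\<^sub>2, \<dots>, \<pi>\<^sub>1\<^sub>K\<close>, where \<open>\<pi>\<^sub>1\<^sub>i\<close> is \<open>\<pi> i\<close>. Outside \<open>{1..K}\<close> the graph family is constantly
  empty and outside \<open>{2..K}\<close> the permutation family is constantly \<open>id\<close>, so a function of
  the graph family depends on \<open>G\<^sub>1, \<dots>, G\<^sub>K\<close> only.\<close>

definition csbm ::
  "nat \<Rightarrow> nat \<Rightarrow> real \<Rightarrow> real \<Rightarrow> real \<Rightarrow> ((nat \<Rightarrow> graph) \<times> (nat \<Rightarrow> nat \<Rightarrow> nat)) pmf" where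
  "csbm K n p q s = do {
     G0 \<leftarrow> sbm n p q;
     G' \<leftarrow> Pi_pmf {1..K} {} (\<lambda>_. random_subset G0 (\<lambda>_. s));
     \<pi> \<leftarrow> Pi_pmf {2..K} id (\<lambda>_. pmf_of_set {\<rho>. \<rho> permutes {1..n}});
     return_pmf (\<lambda>i. if i = 1 then G' 1 else relabel (\<pi> i) (G' i), \<pi>)
   }"

definition matching_estimator ::
  "nat \<Rightarrow> nat \<Rightarrow> ((nat \<Rightarrow> graph) \<Rightarrow> nat \<Rightarrow> nat \<Rightarrow> nat) \<Rightarrow> bool" where
  "matching_estimator K n est \<longleftrightarrow> (\<forall>G. \<forall>i\<in>{2..K}. est G i permutes {1..n})"

end

theory Submission
  imports Defs "HOL-Real_Asymp.Real_Asymp"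
begin

text \<open>Fix a constant \<open>d > 13 K\<^sup>2\<close>. The estimator picks any tuple of permutations under which every
  vertex \<open>v\<close> has, for every cut of the graphs into two nonempty groups, at least \<open>d\<close> neighbours
  joined to \<open>v\<close> by an edge of both groups.

  The true tuple qualifies: across a cut the common degree of \<open>v\<close> is binomial with mean at least
  \<open>s (1 - (1 - s) ^ (K - 1)) (a + b) / 2 \<cdot> ln n\<close> up to a factor tending to 1, the cuts that split
  off a single graph being the worst. Its lower tail at a constant is thus \<open>o(1 / n)\<close>, and a union
  bound over vertices and cuts suffices.

  A wrong tuple does not qualify. Cutting, at each wrongly matched vertex, the graphs where it is
  correctly placed from the others and averaging over pairs of graphs yields one permutation
  \<open>\<tau> \<noteq> id\<close> with \<open>m\<close> moved points and at least \<open>6 m\<close> edges \<open>e\<close> of the parent graph such that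
  \<open>\<tau> e \<noteq> e\<close> is an edge too. A third of these edges form a set disjoint from its \<open>\<tau>\<close>-image, so
  \<open>4 m\<close> prescribed pairs are edges; the number of choices is at most \<open>n ^ m (e n\<^sup>2) ^ m\<close>, against
  a probability \<open>O(ln n / n) ^ (4 m)\<close>.\<close>

section \<open>Matching by common degrees across cuts\<close>

text \<open>\<open>\<rho> i\<close> sends common vertex names to the labels of \<open>G i\<close>,
  so edges are pulled back before they are compared. What is counted is the degree of
  \<open>v\<close> in the intersection of two unions: the pulled-back graphs over \<open>A\<close>
  and those over the complement of \<open>A\<close>.\<close>

definition well_matched ::
  "nat \<Rightarrow> nat \<Rightarrow> nat \<Rightarrow> (nat \<Rightarrow> graph) \<Rightarrow> (nat \<Rightarrow> nat \<Rightarrow> nat) \<Rightarrow> bool" where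
  "well_matched K n d G \<rho> \<longleftrightarrow> (\<forall>v\<in>{1..n}. \<forall>A. A \<noteq> {} \<longrightarrow> A \<subset> {1..K} \<longrightarrow>
     d \<le> card {w\<in>{1..n}. \<exists>i\<in>A. \<exists>j\<in>{1..K} - A. {\<rho> i v, \<rho> i w} \<in> G i \<and> {\<rho> j v, \<rho> j w} \<in> G j})"

text \<open>The 6 is \<open>3 * 2\<close>. A third of the edges survives as a set disjoint from its
  image. With \<open>t * m\<close> such edges, \<open>m\<close> the number of moved points, the
  union bound costs \<open>n ^ (1 - t)\<close> per moved point up to logarithms, and
  \<open>t = 2\<close> is the first integer making this small.\<close>

definition rigid :: "nat \<Rightarrow> graph \<Rightarrow> bool" where
  "rigid n G \<longleftrightarrow> (\<forall>\<tau>. \<tau> permutes {1..n} \<longrightarrow> \<tau> \<noteq> id \<longrightarrow>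
     card {e\<in>G. \<tau> ` e \<in> G \<and> \<tau> ` e \<noteq> e} < 6 * card {v. \<tau> v \<noteq> v})"

lemma finite_vertex_pairs [simp]: "finite (vertex_pairs n)"
  unfolding vertex_pairs_def by (rule finite_subset[of _ "Pow {1..n}"]) auto

lemma finite_moved: "\<tau> permutes {1..n::nat} \<Longrightarrow> finite {v. \<tau> v \<noteq> v}"
  by (rule finite_subset[of _ "{1..n}"]) (auto simp: permutes_def)

lemma card_ordered_pairs_le:
  assumes "X \<subseteq> vertex_pairs n"
  shows "finite {(v, w). {v, w} \<in> X}" and "card {(v, w). {v, w} \<in> X} \<le> 2 * card X"
proof -
  have fX: "finite X" using assms finite_subset finite_vertex_pairs by blast
  have eq: "{(v, w). {v, w} \<in> X} = (\<Union>e\<in>X. {(v, w). {v, w} = e})" by auto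
  have fe: "finite {(v, w). {v, w} = e} \<and> card {(v, w). {v, w} = e} \<le> 2" if "e \<in> X" for e
  proof -
    from that assms have "card e = 2" by (auto simp: vertex_pairs_def)
    then obtain a b where e: "e = {a, b}" by (auto simp: card_2_iff)
    have sub: "{(v, w). {v, w} = e} \<subseteq> {(a, b), (b, a)}"
    proof
      fix x assume "x \<in> {(v, w). {v, w} = e}"
      then obtain v w where x: "x = (v, w)" and "{v, w} = e" by blast
      then have "v = a \<and> w = b \<or> v = b \<and> w = a" unfolding e doubleton_eq_iff by blast
      then show "x \<in> {(a, b), (b, a)}" using x by blast
    qed
    have "card {(v, w). {v, w} = e} \<le> card {(a, b), (b, a)}"
      by (rule card_mono[OF _ sub]) simp
    also have "\<dots> \<le> 2" using card_length[of "[(a, b), (b, a)]"] by simp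
    finally have "card {(v, w). {v, w} = e} \<le> 2" .
    moreover have "finite {(v, w). {v, w} = e}" by (rule finite_subset[OF sub]) (rule finite.intros)+
    ultimately show ?thesis by (rule conjI[rotated])
  qed
  show "finite {(v, w). {v, w} \<in> X}" unfolding eq using fX fe by blast
  have "card (\<Union>e\<in>X. {(v, w). {v, w} = e}) \<le> (\<Sum>e\<in>X. card {(v, w). {v, w} = e})"
    by (rule card_UN_le[OF fX])
  also have "\<dots> \<le> (\<Sum>e\<in>X. 2)" by (rule sum_mono) (use fe in auto)
  finally show "card {(v, w). {v, w} \<in> X} \<le> 2 * card X" unfolding eq by simp
qed

text \<open>The 13 is \<open>1 + 2 * 6\<close>: each moved \<open>v\<close> has at most the one
  neighbour \<open>\<tau> v\<close> on an edge that \<open>\<tau>\<close> fixes, and each of the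
  fewer than \<open>6 * card M\<close> other edges is counted from at most two endpoints.\<close>

lemma rigid_sum_common_degrees_le:
  assumes \<tau>: "\<tau> permutes {1..n}" and G: "G \<subseteq> vertex_pairs n" and r: "rigid n G"
  shows "(\<Sum>v\<in>{v. \<tau> v \<noteq> v}. card {w\<in>{1..n}. {v, w} \<in> G \<and> {\<tau> v, \<tau> w} \<in> G})
           \<le> 13 * card {v. \<tau> v \<noteq> v}"
proof (cases "\<tau> = id")
  case True
  then show ?thesis by simp
next
  case False
  define M where "M = {v. \<tau> v \<noteq> v}"
  define X where "X = {e\<in>G. \<tau> ` e \<in> G \<and> \<tau> ` e \<noteq> e}"
  define N where "N v = {w\<in>{1..n}. {v, w} \<in> G \<and> {\<tau> v, \<tau> w} \<in> G}" for v
  have fM: "finite M" unfolding M_def by (rule finite_moved[OF \<tau>])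
  have X: "X \<subseteq> vertex_pairs n" using G unfolding X_def by auto
  \<comment> \<open>An edge fixed by \<open>\<tau>\<close> with a moved endpoint \<open>v\<close> can only be \<open>{v, \<tau> v}\<close>.\<close>
  have sub: "Sigma M N \<subseteq> (\<lambda>v. (v, \<tau> v)) ` M \<union> {(v, w). {v, w} \<in> X}"
  proof safe
    fix v w assume v: "v \<in> M" and w: "w \<in> N v" and "(v, w) \<notin> (\<lambda>v. (v, \<tau> v)) ` M"
    hence "w \<noteq> \<tau> v" by auto
    moreover have "\<tau> v \<noteq> v" using v by (simp add: M_def)
    ultimately have "\<tau> ` {v, w} \<noteq> {v, w}" by auto
    thus "{v, w} \<in> X" using w unfolding X_def N_def by auto
  qed
  have "(\<Sum>v\<in>M. card (N v)) = card (Sigma M N)"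
    using fM by (intro card_SigmaI[symmetric]) (auto simp: N_def)
  also have "\<dots> \<le> card ((\<lambda>v. (v, \<tau> v)) ` M \<union> {(v, w). {v, w} \<in> X})"
    by (rule card_mono[OF _ sub]) (use fM card_ordered_pairs_le(1)[OF X] in auto)
  also have "\<dots> \<le> card ((\<lambda>v. (v, \<tau> v)) ` M) + card {(v, w). {v, w} \<in> X}"
    by (rule card_Un_le)
  also have "\<dots> \<le> card M + 2 * card X"
    by (rule add_mono[OF card_image_le[OF fM] card_ordered_pairs_le(2)[OF X]])
  also have "\<dots> \<le> 13 * card M"
  proof -
    have "card X < 6 * card M" using r \<tau> False unfolding rigid_def M_def X_def by blast
    then show ?thesis by simp
  qed
  finally show ?thesis unfolding M_def N_def .
qed

text \<open>Substituting \<open>u = f v\<close> replaces the pair \<open>f\<close>, \<open>g\<close>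
  by \<open>id\<close> and \<open>g \<circ> inv f\<close>, which is the previous case.\<close>

lemma rigid_sum_common_degrees2_le:
  assumes f: "f permutes {1..n}" and g: "g permutes {1..n}"
    and G: "G \<subseteq> vertex_pairs n" and r: "rigid n G"
  shows "(\<Sum>v\<in>{v. f v \<noteq> g v}. card {w\<in>{1..n}. {f v, f w} \<in> G \<and> {g v, g w} \<in> G})
           \<le> 13 * card {v. f v \<noteq> g v}"
proof -
  define \<tau> where "\<tau> = g \<circ> inv f"
  have \<tau>: "\<tau> permutes {1..n}"
    unfolding \<tau>_def by (intro permutes_compose permutes_inv f g)
  have \<tau>f: "\<tau> (f v) = g v" for v
    unfolding \<tau>_def using permutes_inverses(2)[OF f] by simp
  have bij: "bij_betw f {v. f v \<noteq> g v} {u. \<tau> u \<noteq> u}"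
    unfolding bij_betw_def
  proof
    show "inj_on f {v. f v \<noteq> g v}"
      using permutes_inj[OF f] by (rule inj_on_subset) simp
    show "f ` {v. f v \<noteq> g v} = {u. \<tau> u \<noteq> u}"
    proof (intro equalityI subsetI)
      fix u assume "u \<in> {u. \<tau> u \<noteq> u}"
      then have "\<tau> u \<noteq> u" by simp
      moreover have "u = f (inv f u)" using permutes_inverses(1)[OF f] by simp
      ultimately have "f (inv f u) \<noteq> g (inv f u)" using \<tau>f[of "inv f u"] by simp
      then show "u \<in> f ` {v. f v \<noteq> g v}" using \<open>u = f (inv f u)\<close> by blast
    next
      fix u assume "u \<in> f ` {v. f v \<noteq> g v}"
      then obtain v where "f v \<noteq> g v" "u = f v" by blast
      then have "\<tau> u \<noteq> u" using \<tau>f[of v] by metis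
      then show "u \<in> {u. \<tau> u \<noteq> u}" by simp
    qed
  qed
  have card_eq: "card {w\<in>{1..n}. {f v, f w} \<in> G \<and> {g v, g w} \<in> G} =
        card {w\<in>{1..n}. {f v, w} \<in> G \<and> {\<tau> (f v), \<tau> w} \<in> G}" for v
  proof (rule bij_betw_same_card[of f])
    show "bij_betw f {w\<in>{1..n}. {f v, f w} \<in> G \<and> {g v, g w} \<in> G}
            {w\<in>{1..n}. {f v, w} \<in> G \<and> {\<tau> (f v), \<tau> w} \<in> G}"
      unfolding bij_betw_def
    proof
      show "inj_on f {w\<in>{1..n}. {f v, f w} \<in> G \<and> {g v, g w} \<in> G}"
        using permutes_inj[OF f] by (rule inj_on_subset) simp
      show "f ` {w\<in>{1..n}. {f v, f w} \<in> G \<and> {g v, g w} \<in> G} =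
            {w\<in>{1..n}. {f v, w} \<in> G \<and> {\<tau> (f v), \<tau> w} \<in> G}"
      proof (intro equalityI subsetI)
        fix u assume "u \<in> f ` {w\<in>{1..n}. {f v, f w} \<in> G \<and> {g v, g w} \<in> G}"
        then obtain w where w: "u = f w" "w \<in> {1..n}" "{f v, f w} \<in> G" "{g v, g w} \<in> G" by blast
        then have "u \<in> {1..n}" using permutes_in_image[OF f] by metis
        then show "u \<in> {w\<in>{1..n}. {f v, w} \<in> G \<and> {\<tau> (f v), \<tau> w} \<in> G}"
          using w by (simp only: \<tau>f mem_Collect_eq simp_thms)
      next
        fix u assume u: "u \<in> {w\<in>{1..n}. {f v, w} \<in> G \<and> {\<tau> (f v), \<tau> w} \<in> G}"
        then obtain w where w: "w \<in> {1..n}" "u = f w"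
          using permutes_image[OF f] by (metis (no_types, lifting) imageE mem_Collect_eq)
        then show "u \<in> f ` {w\<in>{1..n}. {f v, f w} \<in> G \<and> {g v, g w} \<in> G}"
          using u by (simp only: \<tau>f mem_Collect_eq) blast
      qed
    qed
  qed
  have "(\<Sum>v\<in>{v. f v \<noteq> g v}. card {w\<in>{1..n}. {f v, f w} \<in> G \<and> {g v, g w} \<in> G}) =
        (\<Sum>u\<in>{u. \<tau> u \<noteq> u}. card {w\<in>{1..n}. {u, w} \<in> G \<and> {\<tau> u, \<tau> w} \<in> G})"
    unfolding card_eq by (rule sum.reindex_bij_betw[OF bij])
  also have "\<dots> \<le> 13 * card {u. \<tau> u \<noteq> u}"
    by (rule rigid_sum_common_degrees_le[OF \<tau> G r])
  finally show ?thesis using bij_betw_same_card[OF bij] by simp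
qed

text \<open>Here \<open>\<phi> i\<close> is the error made in graph \<open>i\<close>. The proof
  double counts over the set \<open>F\<close> of vertices that some \<open>\<phi> i\<close> moves:
  each has common degree at least \<open>d\<close> across its own cut, and this is charged to pairs
  of graphs that disagree at the vertex. Rigidity allows each of the \<open>K\<^sup>2\<close> pairs
  a total of \<open>13 * card F\<close>, too little for \<open>d > 13 * K\<^sup>2\<close>.\<close>

lemma rigid_well_matched_imp_id:
  assumes perm: "\<And>i. i \<in> {1..K} \<Longrightarrow> \<phi> i permutes {1..n}" and \<phi>1: "\<phi> 1 = id"
    and sub: "\<And>i. i \<in> {1..K} \<Longrightarrow> G i \<subseteq> H" and H: "H \<subseteq> vertex_pairs n" and r: "rigid n H"
    and wm: "well_matched K n d G \<phi>" and d: "13 * K\<^sup>2 < d" and i: "i \<in> {1..K}"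
  shows "\<phi> i = id"
proof (rule ccontr)
  assume ne: "\<phi> i \<noteq> id"
  define F where "F = {v. \<exists>i\<in>{1..K}. \<phi> i v \<noteq> v}"
  define D where "D i j = {v. \<phi> i v \<noteq> \<phi> j v}" for i j
  define N where "N i j v = {w\<in>{1..n}. {\<phi> i v, \<phi> i w} \<in> H \<and> {\<phi> j v, \<phi> j w} \<in> H}" for i j v
  have F_sub: "F \<subseteq> {1..n}" using perm unfolding F_def permutes_def by blast
  hence fF: "finite F" using finite_subset by blast
  obtain v where "\<phi> i v \<noteq> v" using ne by (auto simp: fun_eq_iff)
  then have F_ne: "F \<noteq> {}" using i unfolding F_def by blast
  have DF: "D i j \<subseteq> F" if "i \<in> {1..K}" "j \<in> {1..K}" for i j
  proof
    fix v assume "v \<in> D i j"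
    then have "\<phi> i v \<noteq> \<phi> j v" by (simp add: D_def)
    then have "\<phi> i v \<noteq> v \<or> \<phi> j v \<noteq> v" by metis
    then show "v \<in> F" using that unfolding F_def by blast
  qed
  \<comment> \<open>The cut at \<open>v\<close>: graphs that move \<open>v\<close> against graphs, among them the first, that fix it.\<close>
  have deg: "d \<le> (\<Sum>i\<in>{1..K}. \<Sum>j\<in>{1..K}. if v \<in> D i j then card (N i j v) else 0)" if v: "v \<in> F" for v
  proof -
    define A where "A = {i\<in>{1..K}. \<phi> i v \<noteq> v}"
    have A: "A \<noteq> {}" "A \<subset> {1..K}"
    proof -
      show "A \<noteq> {}" using v unfolding A_def F_def by auto
      have "1 \<notin> A" using \<phi>1 by (simp add: A_def)
      moreover have "1 \<in> {1..K}" using i by simp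
      ultimately show "A \<subset> {1..K}" unfolding A_def by blast
    qed
    have "d \<le> card {w\<in>{1..n}. \<exists>i\<in>A. \<exists>j\<in>{1..K} - A. {\<phi> i v, \<phi> i w} \<in> G i \<and> {\<phi> j v, \<phi> j w} \<in> G j}"
      using wm v F_sub A unfolding well_matched_def by blast
    also have "\<dots> \<le> card (\<Union>i\<in>{1..K}. \<Union>j\<in>{1..K}. if v \<in> D i j then N i j v else {})"
    proof (rule card_mono)
      show "finite (\<Union>i\<in>{1..K}. \<Union>j\<in>{1..K}. if v \<in> D i j then N i j v else {})"
        by (auto simp: N_def)
      show "{w\<in>{1..n}. \<exists>i\<in>A. \<exists>j\<in>{1..K} - A. {\<phi> i v, \<phi> i w} \<in> G i \<and> {\<phi> j v, \<phi> j w} \<in> G j}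
              \<subseteq> (\<Union>i\<in>{1..K}. \<Union>j\<in>{1..K}. if v \<in> D i j then N i j v else {})"
      proof safe
        fix w i j assume w: "w \<in> {1..n}" "i \<in> A" "j \<in> {1..K}" "j \<notin> A"
          "{\<phi> i v, \<phi> i w} \<in> G i" "{\<phi> j v, \<phi> j w} \<in> G j"
        have iK: "i \<in> {1..K}" and "\<phi> i v \<noteq> v" and "\<phi> j v = v" using w by (auto simp: A_def)
        hence "v \<in> D i j" by (simp add: D_def)
        moreover have "w \<in> N i j v" using w sub iK unfolding N_def by blast
        ultimately show "w \<in> (\<Union>i\<in>{1..K}. \<Union>j\<in>{1..K}. if v \<in> D i j then N i j v else {})"
          using iK w(3) by (intro UN_I[of i] UN_I[of j]) simp_all
      qed
    qed
    also have "\<dots> \<le> (\<Sum>i\<in>{1..K}. card (\<Union>j\<in>{1..K}. if v \<in> D i j then N i j v else {}))"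
      by (rule card_UN_le) simp
    also have "\<dots> \<le> (\<Sum>i\<in>{1..K}. \<Sum>j\<in>{1..K}. card (if v \<in> D i j then N i j v else {}))"
      by (intro sum_mono card_UN_le) simp
    also have "\<dots> = (\<Sum>i\<in>{1..K}. \<Sum>j\<in>{1..K}. if v \<in> D i j then card (N i j v) else 0)"
      by (intro sum.cong refl) simp
    finally show ?thesis .
  qed
  have "d * card F = (\<Sum>v\<in>F. d)" by simp
  also have "\<dots> \<le> (\<Sum>v\<in>F. \<Sum>i\<in>{1..K}. \<Sum>j\<in>{1..K}. if v \<in> D i j then card (N i j v) else 0)"
    by (rule sum_mono[OF deg])
  \<comment> \<open>Moving the pair of graphs outside leaves inner sums over the disagreement sets
    \<open>D i j\<close>, which rigidity controls one pair at a time.\<close>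
  also have "\<dots> = (\<Sum>i\<in>{1..K}. \<Sum>v\<in>F. \<Sum>j\<in>{1..K}. if v \<in> D i j then card (N i j v) else 0)"
    by (rule sum.swap)
  also have "\<dots> = (\<Sum>i\<in>{1..K}. \<Sum>j\<in>{1..K}. \<Sum>v\<in>F. if v \<in> D i j then card (N i j v) else 0)"
    by (intro sum.cong refl sum.swap)
  also have "\<dots> = (\<Sum>i\<in>{1..K}. \<Sum>j\<in>{1..K}. \<Sum>v\<in>D i j. card (N i j v))"
  proof (rule sum.cong[OF refl], rule sum.cong[OF refl])
    fix i j assume "i \<in> {1..K}" "j \<in> {1..K}"
    then have "F \<inter> D i j = D i j" using DF by blast
    then show "(\<Sum>v\<in>F. if v \<in> D i j then card (N i j v) else 0) = (\<Sum>v\<in>D i j. card (N i j v))"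
      using sum.inter_restrict[OF fF, of "\<lambda>v. card (N i j v)" "D i j"] by simp
  qed
  also have "\<dots> \<le> (\<Sum>i\<in>{1..K}. \<Sum>j\<in>{1..K}. 13 * card F)"
  proof (intro sum_mono)
    fix i j assume ij: "i \<in> {1..K}" "j \<in> {1..K}"
    have "(\<Sum>v\<in>D i j. card (N i j v)) \<le> 13 * card (D i j)"
      unfolding D_def N_def by (rule rigid_sum_common_degrees2_le[OF perm perm H r]) (use ij in auto)
    also have "\<dots> \<le> 13 * card F" using card_mono[OF fF DF[OF ij]] by simp
    finally show "(\<Sum>v\<in>D i j. card (N i j v)) \<le> 13 * card F" .
  qed
  also have "\<dots> = 13 * K\<^sup>2 * card F" by (simp add: power2_eq_square)
  also have "\<dots> < d * card F" using d F_ne fF by (simp add: card_gt_0_iff)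
  finally show False by simp
qed

section \<open>Relabelling and the estimator\<close>

lemma mem_relabel_iff:
  assumes "\<pi> permutes S"
  shows "e \<in> relabel \<pi> G \<longleftrightarrow> inv \<pi> ` e \<in> G"
proof
  assume "e \<in> relabel \<pi> G"
  then obtain e' where "e' \<in> G" "e = \<pi> ` e'" by (auto simp: relabel_def)
  thus "inv \<pi> ` e \<in> G" using permutes_inv_o(2)[OF assms] by (simp add: image_comp)
next
  assume "inv \<pi> ` e \<in> G"
  moreover have "e = \<pi> ` (inv \<pi> ` e)" using permutes_inv_o(1)[OF assms] by (simp add: image_comp)
  ultimately show "e \<in> relabel \<pi> G" unfolding relabel_def by blast
qed

text \<open>Equivariance: testing a candidate on the observed graphs is the same as testing its
  error tuple on the aligned graphs \<open>G'\<close>, so the latent permutations drop out of the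
  analysis.\<close>

lemma well_matched_relabel:
  assumes "\<And>i. i \<in> {1..K} \<Longrightarrow> \<pi> i permutes {1..n}"
    and "\<And>i. i \<in> {1..K} \<Longrightarrow> G i = relabel (\<pi> i) (G' i)"
  shows "well_matched K n d G \<rho> \<longleftrightarrow> well_matched K n d G' (\<lambda>i. inv (\<pi> i) \<circ> \<rho> i)"
proof -
  have *: "{\<rho> i v, \<rho> i w} \<in> G i \<longleftrightarrow> {inv (\<pi> i) (\<rho> i v), inv (\<pi> i) (\<rho> i w)} \<in> G' i"
    if "i \<in> {1..K}" for i v w
    using mem_relabel_iff[OF assms(1)[OF that], of "{\<rho> i v, \<rho> i w}" "G' i"] assms(2)[OF that] by simp
  have **: "{w\<in>{1..n}. \<exists>i\<in>A. \<exists>j\<in>{1..K} - A. {\<rho> i v, \<rho> i w} \<in> G i \<and> {\<rho> j v, \<rho> j w} \<in> G j} =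
     {w\<in>{1..n}. \<exists>i\<in>A. \<exists>j\<in>{1..K} - A. {inv (\<pi> i) (\<rho> i v), inv (\<pi> i) (\<rho> i w)} \<in> G' i \<and>
        {inv (\<pi> j) (\<rho> j v), inv (\<pi> j) (\<rho> j w)} \<in> G' j}" if "A \<subset> {1..K}" for A v
    using that * by (intro Collect_cong conj_cong refl bex_cong) (auto dest: psubset_imp_subset)
  show ?thesis unfolding well_matched_def o_def using ** by simp
qed

text \<open>\<open>well_matched\<close> does not change when all \<open>\<rho> i\<close> are
  composed on the right with one permutation of the vertices; \<open>\<rho> 1 = id\<close> removes
  this freedom and agrees with the first graph not being relabelled.\<close>

definition admissible ::
  "nat \<Rightarrow> nat \<Rightarrow> nat \<Rightarrow> (nat \<Rightarrow> graph) \<Rightarrow> (nat \<Rightarrow> nat \<Rightarrow> nat) \<Rightarrow> bool" where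
  "admissible K d n G \<rho> \<longleftrightarrow>
     \<rho> 1 = id \<and> (\<forall>i\<in>{1..K}. \<rho> i permutes {1..n}) \<and> well_matched K n d G \<rho>"

text \<open>The fallback \<open>\<lambda>_. id\<close> keeps the values permutations on inputs with
  no admissible tuple, as \<open>matching_estimator\<close> quantifies over all graph
  families.\<close>

definition matcher :: "nat \<Rightarrow> nat \<Rightarrow> nat \<Rightarrow> (nat \<Rightarrow> graph) \<Rightarrow> nat \<Rightarrow> nat \<Rightarrow> nat" where
  "matcher K d n G =
     (if \<exists>\<rho>. admissible K d n G \<rho> then SOME \<rho>. admissible K d n G \<rho> else (\<lambda>_. id))"

lemma admissible_matcher: "admissible K d n G \<rho> \<Longrightarrow> admissible K d n G (matcher K d n G)"
  unfolding matcher_def using someI[of "admissible K d n G" \<rho>] by auto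

lemma matching_estimator_matcher: "matching_estimator K n (matcher K d n)"
proof -
  have "matcher K d n G i permutes {1..n}" if i: "i \<in> {2..K}" for G i
  proof (cases "\<exists>\<rho>. admissible K d n G \<rho>")
    case True
    then have "admissible K d n G (matcher K d n G)" using admissible_matcher by blast
    moreover have "i \<in> {1..K}" using i by simp
    ultimately show ?thesis unfolding admissible_def by blast
  next
    case False
    then have "matcher K d n G = (\<lambda>_. id)" unfolding matcher_def by auto
    then show ?thesis by simp
  qed
  then show ?thesis unfolding matching_estimator_def by blast
qed

text \<open>An error tuple is known to be \<open>id\<close> only at indices in
  \<open>{1..K}\<close>, so it need not equal \<open>\<lambda>_. id\<close> as a function; the test
  looks at these indices alone.\<close>

lemma well_matched_id_cong:
  assumes "\<And>i. i \<in> {1..K} \<Longrightarrow> \<phi> i = id"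
  shows "well_matched K n d G \<phi> \<longleftrightarrow> well_matched K n d G (\<lambda>_. id)"
proof -
  have "{w\<in>{1..n}. \<exists>i\<in>A. \<exists>j\<in>{1..K} - A. {\<phi> i v, \<phi> i w} \<in> G i \<and> {\<phi> j v, \<phi> j w} \<in> G j} =
        {w\<in>{1..n}. \<exists>i\<in>A. \<exists>j\<in>{1..K} - A. {id v, id w} \<in> G i \<and> {id v, id w} \<in> G j}"
    if "A \<subset> {1..K}" for A v
    using that assms by (intro Collect_cong conj_cong refl bex_cong) (auto dest: psubset_imp_subset)
  then show ?thesis unfolding well_matched_def by simp
qed

text \<open>The deterministic core. The true tuple is admissible, hence so is the chosen one; by
  equivariance the error tuple of the choice passes the test on the aligned graphs, and rigidity of
  \<open>H\<close> forces it to be trivial.\<close>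

lemma matcher_eq:
  assumes perm: "\<And>i. i \<in> {1..K} \<Longrightarrow> \<pi> i permutes {1..n}" and \<pi>1: "\<pi> 1 = id"
    and G: "\<And>i. i \<in> {1..K} \<Longrightarrow> G i = relabel (\<pi> i) (G' i)"
    and sub: "\<And>i. i \<in> {1..K} \<Longrightarrow> G' i \<subseteq> H" and H: "H \<subseteq> vertex_pairs n" and r: "rigid n H"
    and wm: "well_matched K n d G' (\<lambda>_. id)" and d: "13 * K\<^sup>2 < d" and i: "i \<in> {1..K}"
  shows "matcher K d n G i = \<pi> i"
proof -
  have iff: "well_matched K n d G \<rho> \<longleftrightarrow> well_matched K n d G' (\<lambda>i. inv (\<pi> i) \<circ> \<rho> i)" for \<rho>
    by (rule well_matched_relabel[OF perm G])
  have "well_matched K n d G' (\<lambda>i. inv (\<pi> i) \<circ> \<pi> i)"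
    by (subst well_matched_id_cong) (use perm wm permutes_inv_o in blast)+
  then have "admissible K d n G \<pi>"
    using perm \<pi>1 iff unfolding admissible_def by blast
  then have P: "admissible K d n G (matcher K d n G)" by (rule admissible_matcher)
  have "(\<lambda>i. inv (\<pi> i) \<circ> matcher K d n G i) i = id"
  proof (rule rigid_well_matched_imp_id[OF _ _ sub H r _ d i])
    show "inv (\<pi> i) \<circ> matcher K d n G i permutes {1..n}" if "i \<in> {1..K}" for i
      using that perm P unfolding admissible_def by (intro permutes_compose permutes_inv) auto
    show "inv (\<pi> 1) \<circ> matcher K d n G 1 = id" using \<pi>1 P by (simp add: admissible_def)
    show "well_matched K n d G' (\<lambda>i. inv (\<pi> i) \<circ> matcher K d n G i)"
      using P iff unfolding admissible_def by blast
  qed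
  hence "\<pi> i \<circ> (inv (\<pi> i) \<circ> matcher K d n G i) = \<pi> i" by simp
  thus ?thesis using permutes_inv_o(1)[OF perm[OF i]] by (simp add: o_assoc)
qed

section \<open>Rigidity of the parent graph\<close>

lemma prob_bind_pmf_le:
  assumes "\<And>x. x \<in> set_pmf M \<Longrightarrow> measure_pmf.prob (N x) E \<le> c" and "0 \<le> c"
  shows "measure_pmf.prob (bind_pmf M N) E \<le> c"
proof -
  have "emeasure (bind_pmf M N) E = (\<integral>\<^sup>+x. emeasure (N x) E \<partial>M)" by simp
  also have "\<dots> \<le> (\<integral>\<^sup>+x. ennreal c \<partial>M)"
    by (rule nn_integral_mono_AE)
       (use assms in \<open>auto simp: AE_measure_pmf_iff measure_pmf.emeasure_eq_measure intro!: ennreal_leI\<close>)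
  also have "\<dots> = ennreal c" by simp
  finally show ?thesis using assms(2) by (simp add: measure_pmf.emeasure_eq_measure)
qed

lemma prob_le_prob_bind_pmf:
  assumes "\<And>x y. x \<in> set_pmf M \<Longrightarrow> x \<in> A \<Longrightarrow> y \<in> set_pmf (N x) \<Longrightarrow> y \<in> E"
  shows "measure_pmf.prob M A \<le> measure_pmf.prob (bind_pmf M N) E"
proof -
  have "emeasure M A = (\<integral>\<^sup>+x. indicator A x \<partial>M)" by simp
  also have "\<dots> \<le> (\<integral>\<^sup>+x. emeasure (N x) E \<partial>M)"
  proof (rule nn_integral_mono_AE, unfold AE_measure_pmf_iff, safe)
    fix x assume x: "x \<in> set_pmf M"
    show "indicator A x \<le> emeasure (N x) E"
    proof (cases "x \<in> A")
      case True
      have "emeasure (N x) E = 1"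
        using assms[OF x True] by (auto simp: measure_pmf.emeasure_eq_1_AE AE_measure_pmf_iff)
      then show ?thesis by (simp add: indicator_def)
    qed simp
  qed
  also have "\<dots> = emeasure (bind_pmf M N) E" by simp
  finally show ?thesis by (simp add: measure_pmf.emeasure_eq_measure)
qed

section \<open>Containment probabilities in random graphs\<close>

lemma random_subset_subset: "finite A \<Longrightarrow> X \<in> set_pmf (random_subset A w) \<Longrightarrow> X \<subseteq> A"
  unfolding random_subset_def by auto

lemma sbm_subset: "G \<in> set_pmf (sbm n p q) \<Longrightarrow> G \<subseteq> vertex_pairs n"
  unfolding sbm_def using random_subset_subset[OF finite_vertex_pairs] by auto

lemma prob_random_subset_superset:
  assumes fin: "finite A" and T: "T \<subseteq> A" and w: "\<And>e. e \<in> A \<Longrightarrow> 0 \<le> w e \<and> w e \<le> 1"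
  shows "measure_pmf.prob (random_subset A w) {X. T \<subseteq> X} = (\<Prod>e\<in>T. w e)"
proof -
  have "measure_pmf.prob (random_subset A w) {X. T \<subseteq> X} =
        measure_pmf.prob (Pi_pmf A False (\<lambda>e. bernoulli_pmf (w e)))
          (Pi A (\<lambda>e. if e \<in> T then {True} else UNIV))"
    unfolding random_subset_def measure_map_pmf
    by (rule arg_cong[where f = "measure_pmf.prob _"]) (use T in \<open>auto simp: Pi_iff split: if_splits\<close>)
  also have "\<dots> = (\<Prod>e\<in>A. measure_pmf.prob (bernoulli_pmf (w e)) (if e \<in> T then {True} else UNIV))"
    by (rule measure_Pi_pmf_Pi[OF fin])
  also have "\<dots> = (\<Prod>e\<in>A. if e \<in> T then w e else 1)"
    by (rule prod.cong) (use w in \<open>auto simp: measure_pmf_single\<close>)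
  also have "\<dots> = (\<Prod>e\<in>T. w e)"
    using prod.inter_restrict[OF fin, of w T] T by (simp add: Int_absorb1)
  finally show ?thesis .
qed

text \<open>Given the labels, the pairs are independent edges with probability \<open>p\<close> or
  \<open>q\<close>, both at most \<open>P\<close>; the bound is thus uniform in the labels and
  survives averaging.\<close>

lemma prob_sbm_superset_le:
  assumes T: "T \<subseteq> vertex_pairs n" and "0 \<le> p" "p \<le> P" "0 \<le> q" "q \<le> P" "P \<le> 1"
  shows "measure_pmf.prob (sbm n p q) {G. T \<subseteq> G} \<le> P ^ card T"
  unfolding sbm_def
proof (rule prob_bind_pmf_le)
  fix \<sigma> :: "nat \<Rightarrow> int"
  define w where "w = (\<lambda>e. if \<forall>i\<in>e. \<forall>j\<in>e. \<sigma> i = \<sigma> j then p else q)"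
  have w: "0 \<le> w e" "w e \<le> P" "w e \<le> 1" for e using assms by (auto simp: w_def)
  have "measure_pmf.prob (random_subset (vertex_pairs n) w) {G. T \<subseteq> G} = (\<Prod>e\<in>T. w e)"
    using w by (intro prob_random_subset_superset T) auto
  also have "\<dots> \<le> (\<Prod>e\<in>T. P)" by (rule prod_mono) (use w in auto)
  finally show "measure_pmf.prob (random_subset (vertex_pairs n)
      (\<lambda>e. if \<forall>i\<in>e. \<forall>j\<in>e. \<sigma> i = \<sigma> j then p else q)) {G. T \<subseteq> G} \<le> P ^ card T"
    by (simp add: w_def)
qed (use assms in auto)

text \<open>Greedy choice: a set \<open>S\<close> of size \<open>t\<close> blocks only
  \<open>S\<close>, its image and its preimage, at most \<open>3 * t\<close> elements, so one more
  element can be added while \<open>3 * t < card X\<close>.\<close>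

lemma exists_subset_disjoint_image:
  assumes f: "inj f" and X: "finite X" "\<And>x. x \<in> X \<Longrightarrow> f x \<noteq> x" and t: "3 * t \<le> card X"
  shows "\<exists>S\<subseteq>X. card S = t \<and> S \<inter> f ` S = {}"
  using t
proof (induction t)
  case 0
  show ?case by (rule exI[of _ "{}"]) simp
next
  case (Suc t)
  then obtain S where S: "S \<subseteq> X" "card S = t" "S \<inter> f ` S = {}" by auto
  have fS: "finite S" using S X finite_subset by blast
  have "card (S \<union> f ` S \<union> (f -` S)) \<le> card S + card (f ` S) + card (f -` S)"
    by (meson add_mono card_Un_le le_trans order_refl)
  also have "\<dots> \<le> t + t + t"
    using S card_image_le[OF fS, of f] card_vimage_inj_on_le[OF inj_on_subset[OF f], of UNIV S] fS by simp
  also have "\<dots> < card X" using Suc.prems by simp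
  finally have "\<not> X \<subseteq> S \<union> f ` S \<union> (f -` S)"
    using fS finite_vimageI[OF fS f] by (meson card_mono finite_UnI finite_imageI not_le)
  then obtain x where x: "x \<in> X" "x \<notin> S" "x \<notin> f ` S" "f x \<notin> S" by blast
  then have "insert x S \<inter> f ` insert x S = {}" using S X(2)[OF x(1)] by auto
  moreover have "card (insert x S) = Suc t" using x S fS by simp
  ultimately show ?case using x S by (intro exI[of _ "insert x S"]) auto
qed

section \<open>Counting configurations that break rigidity\<close>

definition touching :: "nat \<Rightarrow> nat set \<Rightarrow> graph" where
  "touching n M = {e \<in> vertex_pairs n. e \<inter> M \<noteq> {}}"

lemma finite_touching [simp]: "finite (touching n M)"
  unfolding touching_def by simp

lemma card_touching_le:
  assumes "finite M"
  shows "card (touching n M) \<le> card M * n"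
proof -
  have "touching n M \<subseteq> (\<lambda>(v, w). {v, w}) ` (M \<times> {1..n})"
  proof
    fix e assume e: "e \<in> touching n M"
    then obtain v where v: "v \<in> e" "v \<in> M" and e2: "e \<subseteq> {1..n}" "card e = 2"
      unfolding touching_def vertex_pairs_def by blast
    from e2 obtain a b where ab: "e = {a, b}" by (auto simp: card_2_iff)
    then obtain w where "e = {v, w}" using v by (metis insertE insert_commute singletonD)
    then show "e \<in> (\<lambda>(v, w). {v, w}) ` (M \<times> {1..n})" using v e2 by auto
  qed
  then have "card (touching n M) \<le> card ((\<lambda>(v, w). {v, w}) ` (M \<times> {1..n}))"
    using assms by (intro card_mono) auto
  also have "\<dots> \<le> card (M \<times> {1..n})" using assms by (intro card_image_le) auto
  finally show ?thesis by (simp add: card_cartesian_product)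
qed

lemma permutes_image_vertex_pairs:
  assumes "\<tau> permutes {1..n}" "e \<in> vertex_pairs n"
  shows "\<tau> ` e \<in> vertex_pairs n"
proof -
  have "\<tau> ` e \<subseteq> {1..n}" using assms(2) permutes_image[OF assms(1)] unfolding vertex_pairs_def by blast
  moreover have "card (\<tau> ` e) = card e"
    by (rule card_image) (rule inj_on_subset[OF permutes_inj[OF assms(1)]], simp)
  ultimately show ?thesis using assms(2) by (simp add: vertex_pairs_def)
qed

text \<open>Only \<open>S\<close> is recorded, as its image is determined by \<open>\<tau>\<close>.
  The count thus pays for \<open>2 * m\<close> free pairs, \<open>m\<close> the number of moved
  points, while disjointness lets the probability gain from \<open>4 * m\<close> prescribed
  edges.\<close>

definition witnesses :: "nat \<Rightarrow> (nat \<Rightarrow> nat) \<Rightarrow> graph set" where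
  "witnesses n \<tau> = {S. S \<subseteq> touching n {v. \<tau> v \<noteq> v} \<and> card S = 2 * card {v. \<tau> v \<noteq> v} \<and>
     S \<inter> (`) \<tau> ` S = {}}"

text \<open>The greedy choice is applied to the edges that \<open>\<tau>\<close> sends to different
  edges. Such an edge contains a moved point, which is what confines the witness to
  \<open>touching\<close>.\<close>

lemma not_rigid_imp_witness:
  assumes G: "G \<subseteq> vertex_pairs n" and nr: "\<not> rigid n G"
  shows "\<exists>\<tau>. \<tau> permutes {1..n} \<and> \<tau> \<noteq> id \<and> (\<exists>S\<in>witnesses n \<tau>. S \<union> (`) \<tau> ` S \<subseteq> G)"
proof -
  from nr obtain \<tau> where \<tau>: "\<tau> permutes {1..n}" "\<tau> \<noteq> id"
    and le: "6 * card {v. \<tau> v \<noteq> v} \<le> card {e\<in>G. \<tau> ` e \<in> G \<and> \<tau> ` e \<noteq> e}"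
    unfolding rigid_def using not_less by blast
  define X where "X = {e\<in>G. \<tau> ` e \<in> G \<and> \<tau> ` e \<noteq> e}"
  have inj: "inj ((`) \<tau>)" using permutes_inj[OF \<tau>(1)] by (simp add: inj_image_eq_iff inj_def)
  have fX: "finite X" unfolding X_def using G finite_subset[OF G] by simp
  have "\<exists>S\<subseteq>X. card S = 2 * card {v. \<tau> v \<noteq> v} \<and> S \<inter> (`) \<tau> ` S = {}"
    by (rule exists_subset_disjoint_image[OF inj fX]) (use le in \<open>auto simp: X_def\<close>)
  then obtain S where S: "S \<subseteq> X" "card S = 2 * card {v. \<tau> v \<noteq> v}" "S \<inter> (`) \<tau> ` S = {}" by blast
  have "X \<subseteq> touching n {v. \<tau> v \<noteq> v}"
  proof
    fix e assume e: "e \<in> X"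
    have "\<exists>v\<in>e. \<tau> v \<noteq> v"
    proof (rule ccontr)
      assume "\<not> ?thesis"
      then have "\<tau> ` e = e" by force
      then show False using e by (simp add: X_def)
    qed
    then show "e \<in> touching n {v. \<tau> v \<noteq> v}" using e G by (auto simp: touching_def X_def)
  qed
  then have "S \<in> witnesses n \<tau>" using S unfolding witnesses_def by blast
  moreover have "S \<union> (`) \<tau> ` S \<subseteq> G" using S(1) unfolding X_def by blast
  ultimately show ?thesis using \<tau> by blast
qed

text \<open>The left side is a single term of the exponential series, whose terms are all
  nonnegative.\<close>

lemma power_fact_le_exp: "real m ^ k / fact k \<le> exp (real m)"
proof -
  have s: "(\<lambda>n. inverse (fact n) * real m ^ n) sums exp (real m)"
    using exp_converges[of "real m"] by (simp add: scaleR_conv_of_real)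
  have "(\<Sum>n\<in>{k}. inverse (fact n) * real m ^ n) \<le> (\<Sum>n. inverse (fact n) * real m ^ n)"
    using s by (intro sum_le_suminf) (auto simp: sums_iff)
  then show ?thesis using s by (simp add: field_simps sums_iff)
qed

text \<open>There are at most \<open>(m * n) ^ (2 * m) / fact (2 * m)\<close> choices,
  \<open>m\<close> the number of moved points. The factorial absorbs \<open>m ^ (2 * m)\<close> up
  to \<open>exp m\<close>, leaving a base that does not depend on \<open>m\<close>.\<close>

lemma card_witnesses_le:
  assumes \<tau>: "\<tau> permutes {1..n}"
  shows "real (card (witnesses n \<tau>)) \<le> (exp 1 * real n ^ 2) ^ card {v. \<tau> v \<noteq> v}"
proof -
  define M where "M = {v. \<tau> v \<noteq> v}"
  define m where "m = card M"
  have fM: "finite M" unfolding M_def by (rule finite_moved[OF \<tau>])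
  have "card (witnesses n \<tau>) \<le> card {S. S \<subseteq> touching n M \<and> card S = 2 * m}"
    by (rule card_mono) (auto simp: witnesses_def M_def m_def)
  also have "\<dots> = card (touching n M) choose (2 * m)" by (rule n_subsets) simp
  finally have "card (witnesses n \<tau>) * fact (2 * m) \<le> card (touching n M) ^ (2 * m)"
    by (meson binomial_fact_pow le_trans mult_le_mono1)
  also have "\<dots> \<le> (m * n) ^ (2 * m)"
    using card_touching_le[OF fM] by (intro power_mono) (auto simp: m_def)
  finally have "real (card (witnesses n \<tau>) * fact (2 * m)) \<le> real ((m * n) ^ (2 * m))"
    by (rule of_nat_mono)
  then have "real (card (witnesses n \<tau>)) * fact (2 * m) \<le> real m ^ (2 * m) * real n ^ (2 * m)"
    by (simp add: power_mult_distrib)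
  then have "real (card (witnesses n \<tau>)) \<le> real m ^ (2 * m) / fact (2 * m) * real n ^ (2 * m)"
    by (simp add: field_simps)
  also have "\<dots> \<le> exp (real m) * real n ^ (2 * m)"
    by (intro mult_right_mono power_fact_le_exp) simp
  also have "\<dots> = (exp 1 * real n ^ 2) ^ m"
    by (simp add: power_mult_distrib power_mult exp_of_nat_mult[symmetric])
  finally show ?thesis by (simp add: m_def M_def)
qed

text \<open>A permutation permutes its own support: choose the support, then one of its
  \<open>fact m\<close> permutations. The product is a falling factorial.\<close>

lemma card_permutes_card_moved_le:
  "card {\<tau>. \<tau> permutes {1..n::nat} \<and> card {v. \<tau> v \<noteq> v} = m} \<le> n ^ m"
proof -
  define MM where "MM = {M. M \<subseteq> {1..n} \<and> card M = m}"
  have fin: "finite MM" unfolding MM_def by (rule finite_subset[of _ "Pow {1..n}"]) auto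
  have fM: "finite M" if "M \<in> MM" for M using that finite_subset unfolding MM_def by blast
  have "{\<tau>. \<tau> permutes {1..n} \<and> card {v. \<tau> v \<noteq> v} = m} \<subseteq> (\<Union>M\<in>MM. {\<tau>. \<tau> permutes M})"
  proof
    fix \<tau> assume "\<tau> \<in> {\<tau>. \<tau> permutes {1..n} \<and> card {v. \<tau> v \<noteq> v} = m}"
    then have \<tau>: "\<tau> permutes {1..n}" "card {v. \<tau> v \<noteq> v} = m" by auto
    have "\<tau> permutes {v. \<tau> v \<noteq> v}" by (rule permutes_superset[OF \<tau>(1)]) simp
    moreover have "{v. \<tau> v \<noteq> v} \<in> MM" using \<tau> by (auto simp: MM_def permutes_def)
    ultimately show "\<tau> \<in> (\<Union>M\<in>MM. {\<tau>. \<tau> permutes M})" by blast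
  qed
  then have "card {\<tau>. \<tau> permutes {1..n} \<and> card {v. \<tau> v \<noteq> v} = m} \<le> card (\<Union>M\<in>MM. {\<tau>. \<tau> permutes M})"
    by (rule card_mono[rotated]) (use fin fM finite_permutations in auto)
  also have "\<dots> \<le> (\<Sum>M\<in>MM. card {\<tau>. \<tau> permutes M})" by (rule card_UN_le[OF fin])
  also have "\<dots> = (\<Sum>M\<in>MM. fact m)"
  proof (rule sum.cong[OF refl])
    fix M assume "M \<in> MM"
    then have "card M = m" "finite M" using fM unfolding MM_def by blast+
    then show "card {\<tau>. \<tau> permutes M} = fact m" by (rule card_permutations)
  qed
  also have "\<dots> = (n choose m) * fact m" unfolding MM_def by (simp add: n_subsets)
  also have "\<dots> \<le> n ^ m" by (rule binomial_fact_pow)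
  finally show ?thesis .
qed

text \<open>Grouping by the number of moved points gives a geometric series in \<open>n * y\<close>.
  It starts at exponent 1 because \<open>\<tau> \<noteq> id\<close>, and a ratio of at most 1/2
  yields the factor 2.\<close>

lemma sum_permutes_power_moved_le:
  fixes y :: real
  assumes y: "0 \<le> y" and small: "real n * y \<le> 1 / 2"
  shows "(\<Sum>\<tau>\<in>{\<tau>. \<tau> permutes {1..n} \<and> \<tau> \<noteq> id}. y ^ card {v. \<tau> v \<noteq> v}) \<le> 2 * (real n * y)"
proof -
  define T where "T = {\<tau>. \<tau> permutes {1..n} \<and> \<tau> \<noteq> id}"
  define c where "c \<tau> = card {v. \<tau> v \<noteq> v}" for \<tau> :: "nat \<Rightarrow> nat"
  have fp: "finite {\<tau>. \<tau> permutes {1..n}}" by (rule finite_permutations) simp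
  have fT: "finite T" unfolding T_def by (rule finite_subset[OF _ fp]) auto
  have c: "c ` T \<subseteq> {1..n}"
  proof
    fix k assume "k \<in> c ` T"
    then obtain \<tau> where \<tau>: "\<tau> permutes {1..n}" "\<tau> \<noteq> id" "k = c \<tau>" by (auto simp: T_def)
    have "{v. \<tau> v \<noteq> v} \<subseteq> {1..n}" using \<tau>(1) by (auto simp: permutes_def)
    then have "c \<tau> \<le> n" unfolding c_def using card_mono[of "{1..n}"] by fastforce
    moreover have "{v. \<tau> v \<noteq> v} \<noteq> {}" using \<tau>(2) by (auto simp: fun_eq_iff)
    ultimately show "k \<in> {1..n}" using finite_moved[OF \<tau>(1)] \<tau>(3)
      by (simp add: c_def card_gt_0_iff Suc_le_eq)
  qed
  define x where "x = real n * y"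
  have x: "0 \<le> x" "x \<le> 1 / 2" using y small by (auto simp: x_def)
  have "(\<Sum>\<tau>\<in>T. y ^ c \<tau>) = (\<Sum>m\<in>{1..n}. \<Sum>\<tau>\<in>{\<tau>\<in>T. c \<tau> = m}. y ^ c \<tau>)"
    by (rule sum.group[symmetric, OF fT _ c]) simp
  also have "\<dots> \<le> (\<Sum>m\<in>{1..n}. x ^ m)"
  proof (rule sum_mono)
    fix m
    have "(\<Sum>\<tau>\<in>{\<tau>\<in>T. c \<tau> = m}. y ^ c \<tau>) = real (card {\<tau>\<in>T. c \<tau> = m}) * y ^ m" by simp
    also have "card {\<tau>\<in>T. c \<tau> = m} \<le> card {\<tau>. \<tau> permutes {1..n} \<and> card {v. \<tau> v \<noteq> v} = m}"
      by (rule card_mono, rule finite_subset[OF _ fp]) (auto simp: T_def c_def)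
    also have "\<dots> \<le> n ^ m" by (rule card_permutes_card_moved_le)
    finally show "(\<Sum>\<tau>\<in>{\<tau>\<in>T. c \<tau> = m}. y ^ c \<tau>) \<le> x ^ m"
      using y by (simp add: x_def power_mult_distrib mult_right_mono)
  qed
  also have "\<dots> = x * (\<Sum>m<n. x ^ m)"
    by (simp add: sum_distrib_left sum.atLeast1_atMost_eq)
  also have "\<dots> \<le> x * 2"
  proof (rule mult_left_mono[OF _ x(1)])
    have "(\<Sum>m<n. x ^ m) \<le> (\<Sum>m. x ^ m)"
      using x by (intro sum_le_suminf summable_geometric) auto
    also have "\<dots> = 1 / (1 - x)" using x by (intro suminf_geometric) auto
    also have "\<dots> \<le> 2" using x by (simp add: field_simps)
    finally show "(\<Sum>m<n. x ^ m) \<le> 2" .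
  qed
  finally show ?thesis unfolding T_def c_def x_def by simp
qed

text \<open>Union bound over permutations and witnesses. Each moved point costs a factor
  \<open>n\<close> for the permutation and \<open>exp 1 * n\<^sup>2\<close> for the witness, and
  gains \<open>P ^ 4\<close> from its share of the prescribed edges.\<close>

lemma prob_sbm_not_rigid_le:
  assumes pq: "0 \<le> p" "p \<le> P" "0 \<le> q" "q \<le> P" "P \<le> 1"
    and small: "exp 1 * real n ^ 3 * P ^ 4 \<le> 1 / 2"
  shows "measure_pmf.prob (sbm n p q) {G. \<not> rigid n G} \<le> 2 * (exp 1 * real n ^ 3 * P ^ 4)"
proof -
  define T where "T = {\<tau>. \<tau> permutes {1..n} \<and> \<tau> \<noteq> id}"
  define y where "y = exp 1 * real n ^ 2 * P ^ 4"
  have P0: "0 \<le> P" using pq by simp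
  have fT: "finite T" unfolding T_def
    by (rule finite_subset[OF _ finite_permutations[of "{1..n}"]]) auto
  have fW: "finite (witnesses n \<tau>)" for \<tau>
    by (rule finite_subset[of _ "Pow (touching n {v. \<tau> v \<noteq> v})"]) (auto simp: witnesses_def)
  have ny: "real n * y = exp 1 * real n ^ 3 * P ^ 4"
    by (simp add: y_def power2_eq_square power3_eq_cube)
  have "measure_pmf.prob (sbm n p q) {G. \<not> rigid n G} \<le>
        measure_pmf.prob (sbm n p q) (\<Union>\<tau>\<in>T. \<Union>S\<in>witnesses n \<tau>. {G. S \<union> (`) \<tau> ` S \<subseteq> G})"
  \<comment> \<open>The inclusion is used almost surely, because witnesses are extracted from graphs
    inside \<open>vertex_pairs n\<close>.\<close>
  proof (rule measure_pmf.finite_measure_mono_AE)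
    show "AE G in sbm n p q. G \<in> {G. \<not> rigid n G} \<longrightarrow>
        G \<in> (\<Union>\<tau>\<in>T. \<Union>S\<in>witnesses n \<tau>. {G. S \<union> (`) \<tau> ` S \<subseteq> G})"
    proof (unfold AE_measure_pmf_iff, intro ballI impI)
      fix G assume "G \<in> set_pmf (sbm n p q)" and "G \<in> {G. \<not> rigid n G}"
      then obtain \<tau> S where "\<tau> \<in> T" "S \<in> witnesses n \<tau>" "S \<union> (`) \<tau> ` S \<subseteq> G"
        using not_rigid_imp_witness[OF sbm_subset] unfolding T_def by blast
      then show "G \<in> (\<Union>\<tau>\<in>T. \<Union>S\<in>witnesses n \<tau>. {G. S \<union> (`) \<tau> ` S \<subseteq> G})" by blast
    qed
  qed simp
  also have "\<dots> \<le> (\<Sum>\<tau>\<in>T. measure_pmf.prob (sbm n p q) (\<Union>S\<in>witnesses n \<tau>. {G. S \<union> (`) \<tau> ` S \<subseteq> G}))"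
    by (rule measure_UNION_le[OF fT]) simp
  also have "\<dots> \<le> (\<Sum>\<tau>\<in>T. y ^ card {v. \<tau> v \<noteq> v})"
  proof (rule sum_mono)
    fix \<tau> assume "\<tau> \<in> T"
    then have \<tau>: "\<tau> permutes {1..n}" by (simp add: T_def)
    define m where "m = card {v. \<tau> v \<noteq> v}"
    have inj: "inj ((`) \<tau>)" using permutes_inj[OF \<tau>] by (simp add: inj_image_eq_iff inj_def)
    have "measure_pmf.prob (sbm n p q) (\<Union>S\<in>witnesses n \<tau>. {G. S \<union> (`) \<tau> ` S \<subseteq> G})
      \<le> (\<Sum>S\<in>witnesses n \<tau>. measure_pmf.prob (sbm n p q) {G. S \<union> (`) \<tau> ` S \<subseteq> G})"
      by (rule measure_UNION_le[OF fW]) simp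
    also have "\<dots> \<le> (\<Sum>S\<in>witnesses n \<tau>. P ^ (4 * m))"
    proof (rule sum_mono)
      fix S assume S: "S \<in> witnesses n \<tau>"
      have Sv: "S \<subseteq> vertex_pairs n" using S by (auto simp: witnesses_def touching_def)
      have fS: "finite S" by (rule finite_subset[OF Sv]) simp
      have "card (S \<union> (`) \<tau> ` S) = card S + card ((`) \<tau> ` S)"
        using S fS by (intro card_Un_disjoint) (auto simp: witnesses_def)
      also have "card ((`) \<tau> ` S) = card S"
        by (rule card_image) (rule inj_on_subset[OF inj], simp)
      also have "card S = 2 * m" using S by (simp add: witnesses_def m_def)
      finally have "card (S \<union> (`) \<tau> ` S) = 4 * m" by simp
      moreover have "S \<union> (`) \<tau> ` S \<subseteq> vertex_pairs n"
        using Sv permutes_image_vertex_pairs[OF \<tau>] by blast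
      ultimately show "measure_pmf.prob (sbm n p q) {G. S \<union> (`) \<tau> ` S \<subseteq> G} \<le> P ^ (4 * m)"
        using prob_sbm_superset_le[OF _ pq] by metis
    qed
    also have "\<dots> = real (card (witnesses n \<tau>)) * P ^ (4 * m)" by simp
    also have "\<dots> \<le> (exp 1 * real n ^ 2) ^ m * P ^ (4 * m)"
      using card_witnesses_le[OF \<tau>] P0 unfolding m_def by (intro mult_right_mono) auto
    also have "\<dots> = y ^ m" by (simp add: y_def power_mult_distrib power_mult)
    finally show "measure_pmf.prob (sbm n p q) (\<Union>S\<in>witnesses n \<tau>. {G. S \<union> (`) \<tau> ` S \<subseteq> G})
        \<le> y ^ card {v. \<tau> v \<noteq> v}" by (simp add: m_def)
  qed
  also have "\<dots> \<le> 2 * (real n * y)"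
    unfolding T_def
  proof (rule sum_permutes_power_moved_le)
    show "0 \<le> y" by (simp add: y_def P0)
    show "real n * y \<le> 1 / 2" using small unfolding ny .
  qed
  finally show ?thesis by (simp only: ny)
qed

section \<open>Lower tail of the common degree\<close>

lemma expectation_bind_pmf:
  fixes h :: "'b \<Rightarrow> real"
  assumes "finite (set_pmf M)" and "\<And>x. x \<in> set_pmf M \<Longrightarrow> finite (set_pmf (N x))"
  shows "measure_pmf.expectation (bind_pmf M N) h =
         measure_pmf.expectation M (\<lambda>x. measure_pmf.expectation (N x) h)"
proof -
  have "measure_pmf.expectation (bind_pmf M N) h =
        (\<Sum>x\<in>set_pmf M. pmf M x *\<^sub>R measure_pmf.expectation (N x) h)"
    by (rule pmf_expectation_bind[OF assms]) auto
  also have "\<dots> = measure_pmf.expectation M (\<lambda>x. measure_pmf.expectation (N x) h)"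
    by (rule integral_measure_pmf[OF assms(1), symmetric]) auto
  finally show ?thesis .
qed

lemma finite_set_Pi_pmf:
  assumes "finite A" and "\<And>x. x \<in> A \<Longrightarrow> finite (set_pmf (p x))"
  shows "finite (set_pmf (Pi_pmf A d p))"
  unfolding set_Pi_pmf[OF assms(1)] by (rule finite_PiE_dflt) (use assms in auto)

lemma finite_set_random_subset: "finite A \<Longrightarrow> finite (set_pmf (random_subset A w))"
  by (rule finite_subset[of _ "Pow A"]) (auto dest: random_subset_subset)

section \<open>Sampling the children edge by edge\<close>

lemma pmf_Pi_Pi:
  assumes "finite I" and "finite E"
  shows "pmf (Pi_pmf I (\<lambda>_. d) (\<lambda>i. Pi_pmf E d (b i))) g =
    (if \<forall>i e. i \<notin> I \<or> e \<notin> E \<longrightarrow> g i e = d then \<Prod>i\<in>I. \<Prod>e\<in>E. pmf (b i e) (g i e) else 0)"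
proof (cases "\<forall>i e. i \<notin> I \<or> e \<notin> E \<longrightarrow> g i e = d")
  case True
  then have "\<forall>i. i \<notin> I \<longrightarrow> g i = (\<lambda>_. d)" "\<And>i. \<forall>e. e \<notin> E \<longrightarrow> g i e = d" by auto
  then show ?thesis using True by (simp add: pmf_Pi assms)
next
  case False
  show ?thesis
  proof (cases "\<forall>i. i \<notin> I \<longrightarrow> g i = (\<lambda>_. d)")
    case True
    then obtain i e where "i \<in> I" "e \<notin> E" "g i e \<noteq> d" using False by force
    then have "\<exists>i\<in>I. pmf (Pi_pmf E d (b i)) (g i) = 0" by (auto simp: pmf_Pi assms)
    then show ?thesis using False by (simp only: pmf_Pi[OF assms(1)] prod_zero[OF assms(1)]) simp
  next
    case nonconst: False
    show ?thesis unfolding pmf_Pi[OF assms(1)] if_not_P[OF False] if_not_P[OF nonconst] ..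
  qed
qed

text \<open>The mass function of a doubly indexed independent family is a double product, so the
  order of the two indices is immaterial. The model samples graph by graph; the tail bound needs
  independence across edges.\<close>

lemma Pi_pmf_transpose:
  assumes "finite I" and "finite E"
  shows "Pi_pmf I (\<lambda>_. d) (\<lambda>i. Pi_pmf E d (b i)) =
    map_pmf (\<lambda>f i e. f e i) (Pi_pmf E (\<lambda>_. d) (\<lambda>e. Pi_pmf I d (\<lambda>i. b i e)))"
proof (rule pmf_eqI)
  fix g
  let ?M = "Pi_pmf E (\<lambda>_. d) (\<lambda>e. Pi_pmf I d (\<lambda>i. b i e))"
  have "inj (\<lambda>(f :: 'b \<Rightarrow> 'a \<Rightarrow> 'c) i e. f e i)" by (rule injI) (metis ext)
  then have "pmf (map_pmf (\<lambda>f i e. f e i) ?M) g = pmf ?M (\<lambda>e i. g i e)"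
    using pmf_map_inj'[of "\<lambda>f i e. f e i" ?M "\<lambda>e i. g i e"] by simp
  also have "\<dots> = pmf (Pi_pmf I (\<lambda>_. d) (\<lambda>i. Pi_pmf E d (b i))) g"
    unfolding pmf_Pi_Pi[OF assms] pmf_Pi_Pi[OF assms(2,1)] by (subst prod.swap) metis
  finally show "pmf (Pi_pmf I (\<lambda>_. d) (\<lambda>i. Pi_pmf E d (b i))) g = pmf (map_pmf (\<lambda>f i e. f e i) ?M) g" ..
qed

text \<open>Each edge of the parent now carries one independent block of bits, telling which
  children keep it.\<close>

lemma Pi_pmf_random_subset:
  assumes "finite I" and "finite E"
  shows "Pi_pmf I {} (\<lambda>_. random_subset E w) =
    map_pmf (\<lambda>f i. {e\<in>E. f e i}) (Pi_pmf E (\<lambda>_. False) (\<lambda>e. Pi_pmf I False (\<lambda>_. bernoulli_pmf (w e))))"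
proof -
  have "Pi_pmf I {} (\<lambda>_. random_subset E w) = map_pmf (\<lambda>h. (\<lambda>f. {e\<in>E. f e}) \<circ> h)
          (Pi_pmf I (\<lambda>_. False) (\<lambda>_. Pi_pmf E False (\<lambda>e. bernoulli_pmf (w e))))"
    unfolding random_subset_def by (rule Pi_pmf_map[OF assms(1)]) simp
  also have "\<dots> = map_pmf (\<lambda>f i. {e\<in>E. f e i})
      (Pi_pmf E (\<lambda>_. False) (\<lambda>e. Pi_pmf I False (\<lambda>_. bernoulli_pmf (w e))))"
    unfolding Pi_pmf_transpose[OF assms] by (simp add: map_pmf_comp o_def)
  finally show ?thesis .
qed

lemma prob_Pi_bernoulli_none:
  assumes "finite I" "S \<subseteq> I" "0 \<le> s" "s \<le> (1::real)"
  shows "measure_pmf.prob (Pi_pmf I False (\<lambda>_. bernoulli_pmf s)) {g. \<forall>i\<in>S. \<not> g i} = (1 - s) ^ card S"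
proof -
  have "{g. \<forall>i\<in>S. \<not> g i} = Pi I (\<lambda>i. if i \<in> S then {False} else UNIV)"
    using assms(2) by (auto simp: Pi_iff split: if_splits)
  then have "measure_pmf.prob (Pi_pmf I False (\<lambda>_. bernoulli_pmf s)) {g. \<forall>i\<in>S. \<not> g i} =
      (\<Prod>i\<in>I. measure_pmf.prob (bernoulli_pmf s) (if i \<in> S then {False} else UNIV))"
    by (simp only: measure_Pi_pmf_Pi[OF assms(1)])
  also have "\<dots> = (\<Prod>i\<in>I. if i \<in> S then 1 - s else 1)"
    by (rule prod.cong) (use assms in \<open>auto simp: measure_pmf_single\<close>)
  also have "\<dots> = (\<Prod>i\<in>S. 1 - s)"
    using prod.inter_restrict[OF assms(1), of "\<lambda>_. 1 - s" S] assms(2) by (simp add: Int_absorb1)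
  finally show ?thesis by simp
qed

text \<open>The difference of the two sides is
  \<open>u * (1 - u ^ (k - 1)) * (1 - u ^ (l - 1))\<close>. It shows that cuts splitting off one
  graph are the worst.\<close>

lemma one_minus_power_mult_ge:
  fixes u :: real
  assumes "0 \<le> u" "u \<le> 1" "1 \<le> k" "1 \<le> l"
  shows "(1 - u) * (1 - u ^ (k + l - 1)) \<le> (1 - u ^ k) * (1 - u ^ l)"
proof -
  from assms obtain k' l' where kl: "k = Suc k'" "l = Suc l'"
    by (metis One_nat_def Suc_le_D)
  have "u ^ k' \<le> 1" "u ^ l' \<le> 1" using assms by (auto intro: power_le_one)
  then have "0 \<le> u * ((1 - u ^ k') * (1 - u ^ l'))" using assms by (intro mult_nonneg_nonneg) auto
  then show ?thesis unfolding kl by (simp add: algebra_simps power_add)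
qed

text \<open>Inclusion and exclusion gives \<open>(1 - (1 - s) ^ k) * (1 - (1 - s) ^ l)\<close> for
  blocks of sizes \<open>k\<close> and \<open>l\<close>; the worst split \<open>1\<close>,
  \<open>card I - 1\<close> produces the constant of the theorem.\<close>

lemma prob_two_blocks_ge:
  assumes I: "finite I" and A: "A \<subseteq> I" "A \<noteq> {}" "A \<noteq> I" and s: "0 \<le> s" "s \<le> (1::real)"
  shows "s * (1 - (1 - s) ^ (card I - 1)) \<le>
    measure_pmf.prob (Pi_pmf I False (\<lambda>_. bernoulli_pmf s)) {g. (\<exists>i\<in>A. g i) \<and> (\<exists>j\<in>I - A. g j)}"
proof -
  let ?M = "Pi_pmf I False (\<lambda>_. bernoulli_pmf s)"
  let ?N = "\<lambda>S. {g. \<forall>i\<in>S. \<not> g i}"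
  define k where "k = card A"
  define l where "l = card (I - A)"
  have kl: "card I = k + l" "1 \<le> k" "1 \<le> l"
    using A I card_Diff_subset[of A I] card_mono[OF I A(1)] finite_subset[OF A(1) I]
    by (auto simp: k_def l_def Suc_le_eq card_gt_0_iff)
  have "{g. (\<exists>i\<in>A. g i) \<and> (\<exists>j\<in>I - A. g j)} = UNIV - (?N A \<union> ?N (I - A))" by blast
  then have "measure_pmf.prob ?M {g. (\<exists>i\<in>A. g i) \<and> (\<exists>j\<in>I - A. g j)} =
             1 - measure_pmf.prob ?M (?N A \<union> ?N (I - A))"
    using measure_pmf.prob_compl[of "?N A \<union> ?N (I - A)" ?M] by simp
  also have "measure_pmf.prob ?M (?N A \<union> ?N (I - A)) = measure_pmf.prob ?M (?N A) +
      measure_pmf.prob ?M (?N (I - A)) - measure_pmf.prob ?M (?N A \<inter> ?N (I - A))"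
    by (rule measure_Un3) (simp_all add: measure_pmf.fmeasurable_eq_sets)
  also have "?N A \<inter> ?N (I - A) = ?N I" using A(1) by blast
  also have "measure_pmf.prob ?M (?N A) + measure_pmf.prob ?M (?N (I - A)) - measure_pmf.prob ?M (?N I)
      = (1 - s) ^ k + (1 - s) ^ l - (1 - s) ^ (k + l)"
    using A(1) I s unfolding kl(1)[symmetric] by (simp add: prob_Pi_bernoulli_none k_def l_def)
  also have "1 - ((1 - s) ^ k + (1 - s) ^ l - (1 - s) ^ (k + l)) = (1 - (1 - s) ^ k) * (1 - (1 - s) ^ l)"
    by (simp add: algebra_simps power_add)
  also have "\<dots> \<ge> (1 - (1 - s)) * (1 - (1 - s) ^ (k + l - 1))"
    by (rule one_minus_power_mult_ge) (use s kl in auto)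
  finally show ?thesis by (simp add: kl)
qed

lemma expectation_two_valued:
  "measure_pmf.expectation M (\<lambda>g. if C g then x else 1) = 1 - (1 - x) * measure_pmf.prob M {g. C g}"
  for x :: real
proof -
  have "measure_pmf.expectation M (\<lambda>g. if C g then x else 1) =
        measure_pmf.expectation M (\<lambda>g. 1 - (1 - x) * indicator {g. C g} g)"
    by (rule Bochner_Integration.integral_cong) (auto simp: indicator_def)
  also have "\<dots> = 1 - (1 - x) * measure_pmf.prob M {g. C g}"
    by (subst Bochner_Integration.integral_diff) (auto intro!: integrable_mult_right measure_pmf.integrable_const_bound[where B = 1])
  finally show ?thesis .
qed

section \<open>Generating functions of degrees\<close>

definition star :: "nat \<Rightarrow> nat \<Rightarrow> graph" where
  "star n v = (\<lambda>w. {v, w}) ` ({1..n} - {v})"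

lemma inj_pair: "inj (\<lambda>w. {v, w})"
  by (rule injI) (metis doubleton_eq_iff)

lemma finite_star [simp]: "finite (star n v)"
  by (simp add: star_def)

lemma card_neighbours_eq:
  assumes "G \<subseteq> vertex_pairs n" "v \<in> {1..n}"
  shows "card {w\<in>{1..n}. {v, w} \<in> G} = card (G \<inter> star n v)"
proof (rule bij_betw_same_card[of "\<lambda>w. {v, w}"], unfold bij_betw_def, rule conjI)
  show "inj_on (\<lambda>w. {v, w}) {w\<in>{1..n}. {v, w} \<in> G}"
    by (rule inj_on_subset[OF inj_pair]) simp
  have "{v} \<notin> G" using assms(1) by (auto simp: vertex_pairs_def)
  then show "(\<lambda>w. {v, w}) ` {w\<in>{1..n}. {v, w} \<in> G} = G \<inter> star n v"
    unfolding star_def by (auto simp: image_iff)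
qed

lemma star_subset: "v \<in> {1..n} \<Longrightarrow> star n v \<subseteq> vertex_pairs n"
  unfolding star_def vertex_pairs_def by auto

lemma prod_star: "(\<Prod>e\<in>star n v. h e) = (\<Prod>w\<in>{1..n} - {v}. h {v, w})"
  unfolding star_def by (subst prod.reindex) (auto intro: inj_on_subset[OF inj_pair])

text \<open>Given the parent, its edges at \<open>v\<close> are kept on both sides of the cut
  independently of each other, so the generating function factorises; edges away from
  \<open>v\<close> contribute 1.\<close>

lemma expectation_children_power_le:
  assumes A: "A \<subseteq> {1..K}" "A \<noteq> {}" "A \<noteq> {1..K}" and s: "0 \<le> s" "s \<le> 1"
    and x: "0 \<le> x" "x \<le> 1" and G: "G \<subseteq> vertex_pairs n" and v: "v \<in> {1..n}"
  shows "measure_pmf.expectation (Pi_pmf {1..K} {} (\<lambda>_. random_subset G (\<lambda>_. s)))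
     (\<lambda>G'. x ^ card {w\<in>{1..n}. \<exists>i\<in>A. \<exists>j\<in>{1..K} - A. {v, w} \<in> G' i \<and> {v, w} \<in> G' j})
    \<le> (1 - (1 - x) * (s * (1 - (1 - s) ^ (K - 1)))) ^ card (G \<inter> star n v)"
proof -
  define C where "C g \<longleftrightarrow> (\<exists>i\<in>A. g i) \<and> (\<exists>j\<in>{1..K} - A. g j)" for g
  define B where "B = Pi_pmf {1..K} False (\<lambda>_. bernoulli_pmf s)"
  define \<eta> where "\<eta> = measure_pmf.expectation B (\<lambda>g. if C g then x else 1)"
  have fG: "finite G" using G finite_subset by fastforce
  have fB: "finite (set_pmf B)" unfolding B_def by (rule finite_set_Pi_pmf) auto
  have "measure_pmf.expectation (Pi_pmf {1..K} {} (\<lambda>_. random_subset G (\<lambda>_. s)))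
     (\<lambda>G'. x ^ card {w\<in>{1..n}. \<exists>i\<in>A. \<exists>j\<in>{1..K} - A. {v, w} \<in> G' i \<and> {v, w} \<in> G' j}) =
    measure_pmf.expectation (Pi_pmf G (\<lambda>_. False) (\<lambda>_. B))
      (\<lambda>f. x ^ card {w\<in>{1..n}. \<exists>i\<in>A. \<exists>j\<in>{1..K} - A. {v, w} \<in> {e\<in>G. f e i} \<and> {v, w} \<in> {e\<in>G. f e j}})"
    by (simp only: Pi_pmf_random_subset[OF _ fG] finite_atLeastAtMost integral_map_pmf B_def)
  also have "\<dots> = measure_pmf.expectation (Pi_pmf G (\<lambda>_. False) (\<lambda>_. B))
      (\<lambda>f. \<Prod>e\<in>G. if e \<in> star n v \<and> C (f e) then x else 1)"
  proof (rule Bochner_Integration.integral_cong[OF refl])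
    fix f :: "nat set \<Rightarrow> nat \<Rightarrow> bool"
    have "{w\<in>{1..n}. \<exists>i\<in>A. \<exists>j\<in>{1..K} - A. {v, w} \<in> {e\<in>G. f e i} \<and> {v, w} \<in> {e\<in>G. f e j}} =
          {w\<in>{1..n}. {v, w} \<in> {e\<in>G. C (f e)}}" unfolding C_def by blast
    moreover have "card {w\<in>{1..n}. {v, w} \<in> {e\<in>G. C (f e)}} = card ({e\<in>G. C (f e)} \<inter> star n v)"
      by (rule card_neighbours_eq[OF _ v]) (use G in blast)
    moreover have "{e\<in>G. C (f e)} \<inter> star n v = {e\<in>G. e \<in> star n v \<and> C (f e)}" by blast
    moreover have "(\<Prod>e\<in>G. if e \<in> star n v \<and> C (f e) then x else 1) = x ^ card {e\<in>G. e \<in> star n v \<and> C (f e)}"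
      using prod.inter_filter[OF fG, of "\<lambda>_. x" "\<lambda>e. e \<in> star n v \<and> C (f e)"] by simp
    ultimately show "x ^ card {w\<in>{1..n}. \<exists>i\<in>A. \<exists>j\<in>{1..K} - A. {v, w} \<in> {e\<in>G. f e i} \<and> {v, w} \<in> {e\<in>G. f e j}}
        = (\<Prod>e\<in>G. if e \<in> star n v \<and> C (f e) then x else 1)" by metis
  qed
  also have "\<dots> = (\<Prod>e\<in>G. measure_pmf.expectation B (\<lambda>g. if e \<in> star n v \<and> C g then x else 1))"
    by (rule expectation_prod_Pi_pmf[OF fG]) (use x fB in \<open>auto intro: integrable_measure_pmf_finite\<close>)
  also have "\<dots> = (\<Prod>e\<in>G. if e \<in> star n v then \<eta> else 1)"
    by (rule prod.cong[OF refl]) (simp add: \<eta>_def)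
  also have "\<dots> = \<eta> ^ card (G \<inter> star n v)"
    using prod.inter_restrict[OF fG, of "\<lambda>_. \<eta>" "star n v"] by simp
  also have "\<dots> \<le> (1 - (1 - x) * (s * (1 - (1 - s) ^ (K - 1)))) ^ card (G \<inter> star n v)"
  \<comment> \<open>As \<open>x \<le> 1\<close>, the factor \<open>\<eta>\<close> of one edge
    decreases in the probability of survival, so a lower bound on that probability bounds
    \<open>\<eta>\<close> from above.\<close>
  proof (rule power_mono)
    show "0 \<le> \<eta>" unfolding \<eta>_def by (rule Bochner_Integration.integral_nonneg) (use x in auto)
    have "s * (1 - (1 - s) ^ (K - 1)) \<le> measure_pmf.prob B {g. C g}"
      using prob_two_blocks_ge[OF _ A s] unfolding B_def C_def by simp
    then have "(1 - x) * (s * (1 - (1 - s) ^ (K - 1))) \<le> (1 - x) * measure_pmf.prob B {g. C g}"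
      using x by (intro mult_left_mono) auto
    then show "\<eta> \<le> 1 - (1 - x) * (s * (1 - (1 - s) ^ (K - 1)))"
      unfolding \<eta>_def expectation_two_valued by simp
  qed
  finally show ?thesis .
qed

lemma expectation_random_subset_power:
  assumes fin: "finite V" and T: "T \<subseteq> V" and w: "\<And>e. e \<in> V \<Longrightarrow> 0 \<le> w e \<and> w e \<le> 1" and y: "0 \<le> y"
  shows "measure_pmf.expectation (random_subset V w) (\<lambda>G. y ^ card (G \<inter> T)) = (\<Prod>e\<in>T. 1 - w e * (1 - y))"
proof -
  have "measure_pmf.expectation (random_subset V w) (\<lambda>G. y ^ card (G \<inter> T)) =
        measure_pmf.expectation (Pi_pmf V False (\<lambda>e. bernoulli_pmf (w e))) (\<lambda>f. y ^ card ({e\<in>V. f e} \<inter> T))"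
    by (simp add: random_subset_def)
  also have "\<dots> = measure_pmf.expectation (Pi_pmf V False (\<lambda>e. bernoulli_pmf (w e)))
      (\<lambda>f. \<Prod>e\<in>V. if e \<in> T \<and> f e then y else 1)"
  proof (rule Bochner_Integration.integral_cong[OF refl])
    fix f
    have "{e\<in>V. f e} \<inter> T = {e\<in>V. e \<in> T \<and> f e}" by blast
    then show "y ^ card ({e\<in>V. f e} \<inter> T) = (\<Prod>e\<in>V. if e \<in> T \<and> f e then y else 1)"
      using prod.inter_filter[OF fin, of "\<lambda>_. y" "\<lambda>e. e \<in> T \<and> f e"] by simp
  qed
  also have "\<dots> = (\<Prod>e\<in>V. measure_pmf.expectation (bernoulli_pmf (w e)) (\<lambda>b. if e \<in> T \<and> b then y else 1))"
    by (rule expectation_prod_Pi_pmf[OF fin]) (use y in \<open>auto intro: integrable_measure_pmf_finite\<close>)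
  also have "\<dots> = (\<Prod>e\<in>V. if e \<in> T then 1 - w e * (1 - y) else 1)"
    by (rule prod.cong[OF refl]) (use w in \<open>auto simp: algebra_simps\<close>)
  also have "\<dots> = (\<Prod>e\<in>T. 1 - w e * (1 - y))"
    using prod.inter_restrict[OF fin, of "\<lambda>e. 1 - w e * (1 - y)" T] T by (simp add: Int_absorb1)
  finally show ?thesis .
qed

text \<open>Once the label of \<open>v\<close> is fixed, the other labels agree with it
  independently with probability 1/2, and the result is the same for both values of the label of
  \<open>v\<close>.\<close>

lemma expectation_labels_prod:
  fixes c c' :: real
  assumes v: "v \<in> {1..n}" and c: "0 \<le> c" "0 \<le> c'"
  shows "measure_pmf.expectation (labels_pmf n) (\<lambda>\<sigma>. \<Prod>w\<in>{1..n} - {v}. if \<sigma> v = \<sigma> w then c else c') =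
    ((c + c') / 2) ^ (n - 1)"
proof -
  let ?U = "pmf_of_set {1, -1 :: int}"
  define R where "R = {1..n} - {v}"
  have R: "finite R" "v \<notin> R" "insert v R = {1..n}" "card R = n - 1" using v by (auto simp: R_def)
  have fU: "finite (set_pmf ?U)" "set_pmf ?U = {1, -1}" by (simp_all add: set_pmf_of_set)
  have "measure_pmf.expectation (labels_pmf n) (\<lambda>\<sigma>. \<Prod>w\<in>R. if \<sigma> v = \<sigma> w then c else c') =
    measure_pmf.expectation (map_pmf (\<lambda>(y, f). f(v := y)) (pair_pmf ?U (Pi_pmf R 0 (\<lambda>_. ?U))))
      (\<lambda>\<sigma>. \<Prod>w\<in>R. if \<sigma> v = \<sigma> w then c else c')"
    unfolding labels_pmf_def R(3)[symmetric] Pi_pmf_insert[OF R(1,2)] ..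
  also have "\<dots> = measure_pmf.expectation (pair_pmf ?U (Pi_pmf R 0 (\<lambda>_. ?U)))
      (\<lambda>(y, f). \<Prod>w\<in>R. if y = f w then c else c')"
    unfolding integral_map_pmf
    by (rule Bochner_Integration.integral_cong[OF refl])
       (use R(2) in \<open>auto simp: case_prod_beta intro!: prod.cong\<close>)
  also have "\<dots> = measure_pmf.expectation ?U
     (\<lambda>y. measure_pmf.expectation (Pi_pmf R 0 (\<lambda>_. ?U)) (\<lambda>f. \<Prod>w\<in>R. if y = f w then c else c'))"
    unfolding pair_pmf_def
    by (subst expectation_bind_pmf[OF fU(1)])
       (auto simp: map_pmf_def[symmetric] intro!: finite_set_Pi_pmf R)
  also have "\<dots> = measure_pmf.expectation ?U (\<lambda>y. ((c + c') / 2) ^ (n - 1))"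
  proof (rule integral_cong_AE, simp, simp, unfold AE_measure_pmf_iff, rule ballI)
    fix y assume "y \<in> set_pmf ?U"
    then have y: "y = 1 \<or> y = -1" using fU by simp
    have "measure_pmf.expectation (Pi_pmf R 0 (\<lambda>_. ?U)) (\<lambda>f. \<Prod>w\<in>R. if y = f w then c else c') =
      (\<Prod>w\<in>R. measure_pmf.expectation ?U (\<lambda>z. if y = z then c else c'))"
      by (rule expectation_prod_Pi_pmf[OF R(1)]) (use c fU in \<open>auto intro: integrable_measure_pmf_finite\<close>)
    also have "\<dots> = (\<Prod>w\<in>R. (c + c') / 2)"
      using y by (intro prod.cong refl) (auto simp: integral_pmf_of_set)
    finally show "measure_pmf.expectation (Pi_pmf R 0 (\<lambda>_. ?U)) (\<lambda>f. \<Prod>w\<in>R. if y = f w then c else c')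
      = ((c + c') / 2) ^ (n - 1)" by (simp add: R(4))
  qed
  finally show ?thesis by (simp add: R_def)
qed

lemma finite_set_labels_pmf: "finite (set_pmf (labels_pmf n))"
  unfolding labels_pmf_def by (rule finite_set_Pi_pmf) (auto simp: set_pmf_of_set)

lemma finite_set_sbm: "finite (set_pmf (sbm n p q))"
  by (rule finite_subset[of _ "Pow (vertex_pairs n)"]) (auto dest: sbm_subset)

text \<open>This is the generating function of a binomial law with parameters \<open>n - 1\<close>
  and \<open>(p + q) / 2\<close>: averaged over the labels, the degree of a single vertex is exactly
  binomial.\<close>

lemma expectation_sbm_power_degree:
  assumes v: "v \<in> {1..n}" and pq: "0 \<le> p" "p \<le> 1" "0 \<le> q" "q \<le> 1" and y: "0 \<le> y" "y \<le> 1"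
  shows "measure_pmf.expectation (sbm n p q) (\<lambda>G. y ^ card (G \<inter> star n v)) =
         (1 - (p + q) / 2 * (1 - y)) ^ (n - 1)"
proof -
  let ?w = "\<lambda>(\<sigma> :: nat \<Rightarrow> int) e. if \<forall>i\<in>e. \<forall>j\<in>e. \<sigma> i = \<sigma> j then p else q"
  have "measure_pmf.expectation (sbm n p q) (\<lambda>G. y ^ card (G \<inter> star n v)) =
    measure_pmf.expectation (labels_pmf n)
      (\<lambda>\<sigma>. measure_pmf.expectation (random_subset (vertex_pairs n) (?w \<sigma>)) (\<lambda>G. y ^ card (G \<inter> star n v)))"
    unfolding sbm_def
    by (rule expectation_bind_pmf[OF finite_set_labels_pmf finite_set_random_subset]) simp
  also have "\<dots> = measure_pmf.expectation (labels_pmf n)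
      (\<lambda>\<sigma>. \<Prod>w\<in>{1..n} - {v}. if \<sigma> v = \<sigma> w then 1 - p * (1 - y) else 1 - q * (1 - y))"
  proof (rule Bochner_Integration.integral_cong[OF refl])
    fix \<sigma> :: "nat \<Rightarrow> int"
    have "measure_pmf.expectation (random_subset (vertex_pairs n) (?w \<sigma>)) (\<lambda>G. y ^ card (G \<inter> star n v)) =
          (\<Prod>e\<in>star n v. 1 - ?w \<sigma> e * (1 - y))"
      by (rule expectation_random_subset_power) (use star_subset[OF v] pq y in auto)
    also have "\<dots> = (\<Prod>w\<in>{1..n} - {v}. if \<sigma> v = \<sigma> w then 1 - p * (1 - y) else 1 - q * (1 - y))"
      unfolding prod_star by (intro prod.cong refl) auto
    finally show "measure_pmf.expectation (random_subset (vertex_pairs n) (?w \<sigma>)) (\<lambda>G. y ^ card (G \<inter> star n v)) =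
      (\<Prod>w\<in>{1..n} - {v}. if \<sigma> v = \<sigma> w then 1 - p * (1 - y) else 1 - q * (1 - y))" .
  qed
  also have "\<dots> = ((1 - p * (1 - y) + (1 - q * (1 - y))) / 2) ^ (n - 1)"
    by (rule expectation_labels_prod[OF v]) (use pq y in \<open>auto intro!: mult_le_one\<close>)
  also have "(1 - p * (1 - y) + (1 - q * (1 - y))) / 2 = 1 - (p + q) / 2 * (1 - y)"
    by (simp add: field_simps)
  finally show ?thesis .
qed

text \<open>The model before relabelling, with the parent kept: rigidity concerns the parent and the
  degree test concerns the children, so both events need one common space.\<close>

definition parent_children ::
  "nat \<Rightarrow> nat \<Rightarrow> real \<Rightarrow> real \<Rightarrow> real \<Rightarrow> (graph \<times> (nat \<Rightarrow> graph)) pmf" where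
  "parent_children K n p q s = do {
     G \<leftarrow> sbm n p q;
     G' \<leftarrow> Pi_pmf {1..K} {} (\<lambda>_. random_subset G (\<lambda>_. s));
     return_pmf (G, G')
   }"

text \<open>Markov's inequality for \<open>x ^ D\<close>, the Chernoff method with base
  \<open>x\<close>. The threshold \<open>d\<close> costs only \<open>(1 / x) ^ d\<close>, a constant
  for fixed \<open>d\<close>.\<close>

lemma prob_small_common_degree_le:
  assumes A: "A \<subseteq> {1..K}" "A \<noteq> {}" "A \<noteq> {1..K}" and s: "0 \<le> s" "s \<le> 1"
    and x: "0 < x" "x \<le> 1" and v: "v \<in> {1..n}" and pq: "0 \<le> p" "p \<le> 1" "0 \<le> q" "q \<le> 1"
  shows "measure_pmf.prob (parent_children K n p q s)
     {(G, G'). card {w\<in>{1..n}. \<exists>i\<in>A. \<exists>j\<in>{1..K} - A. {v, w} \<in> G' i \<and> {v, w} \<in> G' j} < d}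
   \<le> (1 / x) ^ d * (1 - (p + q) / 2 * ((1 - x) * (s * (1 - (1 - s) ^ (K - 1))))) ^ (n - 1)"
proof -
  define D where
    "D G' = card {w\<in>{1..n}. \<exists>i\<in>A. \<exists>j\<in>{1..K} - A. {v, w} \<in> G' i \<and> {v, w} \<in> G' j}" for G' :: "nat \<Rightarrow> graph"
  define \<theta> where "\<theta> = s * (1 - (1 - s) ^ (K - 1))"
  \<comment> \<open>Thinning composes: averaging \<open>x ^ D\<close> over the children leaves at
    most a power of \<open>y\<close> whose exponent is the degree of \<open>v\<close> in the
    parent.\<close>
  define y where "y = 1 - (1 - x) * \<theta>"
  let ?N = "\<lambda>G. Pi_pmf {1..K} {} (\<lambda>_. random_subset G (\<lambda>_. s))"
  have fV: "finite (set_pmf (?N G))" if "G \<in> set_pmf (sbm n p q)" for G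
    using finite_subset[OF sbm_subset[OF that] finite_vertex_pairs]
    by (intro finite_set_Pi_pmf finite_set_random_subset) auto
  have fpc: "finite (set_pmf (parent_children K n p q s))"
    unfolding parent_children_def using finite_set_sbm fV by auto
  have "0 \<le> \<theta>" "\<theta> \<le> 1"
    unfolding \<theta>_def using s by (auto intro!: mult_nonneg_nonneg mult_le_one power_le_one)
  then have y: "0 \<le> y" "y \<le> 1" unfolding y_def using x by (auto intro!: mult_le_one)
  have "measure_pmf.prob (parent_children K n p q s) {(G, G'). D G' < d} =
      measure_pmf.expectation (parent_children K n p q s) (indicator {(G, G'). D G' < d})" by simp
  also have "\<dots> \<le> measure_pmf.expectation (parent_children K n p q s) (\<lambda>(G, G'). (1 / x) ^ d * x ^ D G')"
  proof (rule integral_mono)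
    fix \<omega> :: "graph \<times> (nat \<Rightarrow> graph)"
    obtain G G' where \<omega>: "\<omega> = (G, G')" by (cases \<omega>)
    have "1 \<le> (1 / x) ^ d * x ^ D G'" if "D G' < d"
    proof -
      have "x ^ d \<le> x ^ D G'" using that x by (intro power_decreasing) auto
      then show ?thesis using x by (simp add: field_simps)
    qed
    then show "indicator {(G, G'). D G' < d} \<omega> \<le> (case \<omega> of (G, G') \<Rightarrow> (1 / x) ^ d * x ^ D G')"
      using x unfolding \<omega> by (auto simp: indicator_def)
  qed (use fpc in \<open>auto intro: integrable_measure_pmf_finite\<close>)
  also have "\<dots> = (1 / x) ^ d * measure_pmf.expectation (parent_children K n p q s) (\<lambda>(G, G'). x ^ D G')"
    unfolding case_prod_beta by (rule integral_mult_right_zero)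
  also have "measure_pmf.expectation (parent_children K n p q s) (\<lambda>(G, G'). x ^ D G') =
      measure_pmf.expectation (sbm n p q) (\<lambda>G. measure_pmf.expectation (?N G) (\<lambda>G'. x ^ D G'))"
    unfolding parent_children_def
    by (subst expectation_bind_pmf[OF finite_set_sbm]) (use fV in \<open>auto simp: map_pmf_def[symmetric]\<close>)
  also have "\<dots> \<le> measure_pmf.expectation (sbm n p q) (\<lambda>G. y ^ card (G \<inter> star n v))"
  proof (rule integral_mono_AE)
    show "AE G in sbm n p q. measure_pmf.expectation (?N G) (\<lambda>G'. x ^ D G') \<le> y ^ card (G \<inter> star n v)"
      unfolding AE_measure_pmf_iff D_def y_def \<theta>_def
      using expectation_children_power_le[OF A s _ x(2) sbm_subset v] x(1) by simp
  qed (auto intro!: integrable_measure_pmf_finite finite_set_sbm)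
  also have "\<dots> = (1 - (p + q) / 2 * (1 - y)) ^ (n - 1)"
    by (rule expectation_sbm_power_degree[OF v pq y])
  finally show ?thesis using x unfolding y_def \<theta>_def D_def by (simp add: mult_left_mono)
qed

section \<open>Exact matching\<close>

lemma average_rate_bounds:
  fixes s x p q :: real
  assumes s: "0 \<le> s" "s \<le> 1" and x: "0 < x" "x \<le> 1" and pq: "0 \<le> p" "p \<le> 1" "0 \<le> q" "q \<le> 1"
  shows "0 \<le> (p + q) / 2 * ((1 - x) * (s * (1 - (1 - s) ^ k)))"
    and "(p + q) / 2 * ((1 - x) * (s * (1 - (1 - s) ^ k))) \<le> 1"
proof -
  define u where "u = (1 - s) ^ k"
  have u: "0 \<le> u" "u \<le> 1" unfolding u_def using s by (auto intro: power_le_one)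
  have \<theta>: "0 \<le> s * (1 - u)" "s * (1 - u) \<le> 1" using s u by (auto intro: mult_le_one)
  have y: "0 \<le> (1 - x) * (s * (1 - u))" "(1 - x) * (s * (1 - u)) \<le> 1"
    using mult_nonneg_nonneg[of "1 - x" "s * (1 - u)"] mult_le_one[of "1 - x" "s * (1 - u)"] x \<theta> by auto
  have r: "0 \<le> (p + q) / 2" "(p + q) / 2 \<le> 1" using pq by auto
  show "0 \<le> (p + q) / 2 * ((1 - x) * (s * (1 - (1 - s) ^ k)))"
    using mult_nonneg_nonneg[OF r(1) y(1)] unfolding u_def .
  show "(p + q) / 2 * ((1 - x) * (s * (1 - (1 - s) ^ k))) \<le> 1"
    using mult_le_one[OF r(2) y] unfolding u_def .
qed

lemma prob_not_well_matched_le: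
  assumes s: "0 \<le> s" "s \<le> 1" and x: "0 < x" "x \<le> 1" and pq: "0 \<le> p" "p \<le> 1" "0 \<le> q" "q \<le> 1"
  shows "measure_pmf.prob (parent_children K n p q s) {(G, G'). \<not> well_matched K n d G' (\<lambda>_. id)}
   \<le> real n * 2 ^ K * ((1 / x) ^ d * (1 - (p + q) / 2 * ((1 - x) * (s * (1 - (1 - s) ^ (K - 1))))) ^ (n - 1))"
    (is "_ \<le> _ * ?b")
proof -
  let ?E = "\<lambda>A v. {(G, G'). card {w\<in>{1..n}. \<exists>i\<in>A. \<exists>j\<in>{1..K} - A. {v, w} \<in> G' i \<and> {v, w} \<in> G' j} < d}
     :: (graph \<times> (nat \<Rightarrow> graph)) set"
  define PA where "PA = {A. A \<noteq> {} \<and> A \<subset> {1..K}}"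
  have PA: "PA \<subseteq> Pow {1..K}" by (auto simp: PA_def)
  have fPA: "finite PA" by (rule finite_subset[OF PA]) simp
  have cPA: "card PA \<le> 2 ^ K" using card_mono[OF _ PA] by (simp add: card_Pow)
  let ?P = "measure_pmf.prob (parent_children K n p q s)"
  have b: "?P (?E A v) \<le> ?b" if "A \<in> PA" "v \<in> {1..n}" for A v
    by (rule prob_small_common_degree_le[OF _ _ _ s x that(2) pq]) (use that(1) in \<open>auto simp: PA_def\<close>)
  have "{(G, G'). \<not> well_matched K n d G' (\<lambda>_. id)} \<subseteq> (\<Union>v\<in>{1..n}. \<Union>A\<in>PA. ?E A v)"
  proof clarify
    fix G :: graph and G' :: "nat \<Rightarrow> graph"
    assume "\<not> well_matched K n d G' (\<lambda>_. id)"
    then obtain v A where "v \<in> {1..n}" "A \<in> PA"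
      "\<not> d \<le> card {w\<in>{1..n}. \<exists>i\<in>A. \<exists>j\<in>{1..K} - A. {v, w} \<in> G' i \<and> {v, w} \<in> G' j}"
      unfolding well_matched_def PA_def id_apply by blast
    then show "(G, G') \<in> (\<Union>v\<in>{1..n}. \<Union>A\<in>PA. ?E A v)"
      unfolding not_le by blast
  qed
  then have "?P {(G, G'). \<not> well_matched K n d G' (\<lambda>_. id)} \<le> ?P (\<Union>v\<in>{1..n}. \<Union>A\<in>PA. ?E A v)"
    by (rule measure_pmf.finite_measure_mono) simp
  also have "\<dots> \<le> (\<Sum>v\<in>{1..n}. ?P (\<Union>A\<in>PA. ?E A v))"
    by (rule measure_UNION_le) simp_all
  also have "\<dots> \<le> (\<Sum>v\<in>{1..n}. \<Sum>A\<in>PA. ?P (?E A v))"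
    by (intro sum_mono measure_UNION_le fPA) simp
  also have "\<dots> \<le> (\<Sum>v\<in>{1..n}. \<Sum>A\<in>PA. ?b)"
    by (intro sum_mono b)
  also have "\<dots> = real n * real (card PA) * ?b" by simp
  also have "\<dots> \<le> real n * 2 ^ K * ?b"
  proof (rule mult_right_mono)
    show "real n * real (card PA) \<le> real n * 2 ^ K"
      using cPA by (intro mult_left_mono) (metis of_nat_le_iff of_nat_numeral of_nat_power, simp)
    show "0 \<le> ?b" using x average_rate_bounds(2)[OF s x pq, of "K - 1"] by simp
  qed
  finally show ?thesis .
qed

text \<open>The observed model is \<open>parent_children\<close> followed by independent
  relabelling, and on the good event the matcher succeeds for every outcome of the
  permutations.\<close>

lemma prob_matcher_ge:
  assumes d: "13 * K\<^sup>2 < d"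
  shows "measure_pmf.prob (parent_children K n p q s)
           {(G, G'). rigid n G \<and> well_matched K n d G' (\<lambda>_. id)}
    \<le> measure_pmf.prob (csbm K n p q s) {(G, \<pi>). \<forall>i\<in>{2..K}. matcher K d n G i = \<pi> i}"
proof -
  let ?R = "pmf_of_set {\<rho>. \<rho> permutes {1..n}}"
  let ?N = "\<lambda>(G :: graph, G' :: nat \<Rightarrow> graph). Pi_pmf {2..K} id (\<lambda>_. ?R) \<bind>
      (\<lambda>\<pi>. return_pmf (\<lambda>i. if i = 1 then G' 1 else relabel (\<pi> i) (G' i), \<pi>))"
  have csbm: "csbm K n p q s = parent_children K n p q s \<bind> ?N"
    unfolding csbm_def parent_children_def by (simp add: bind_assoc_pmf bind_return_pmf)
  show ?thesis unfolding csbm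
  proof (rule prob_le_prob_bind_pmf)
    fix \<omega> :: "graph \<times> (nat \<Rightarrow> graph)" and y
    obtain H G' where \<omega>: "\<omega> = (H, G')" by (cases \<omega>)
    assume "\<omega> \<in> set_pmf (parent_children K n p q s)"
      and "\<omega> \<in> {(G, G'). rigid n G \<and> well_matched K n d G' (\<lambda>_. id)}"
      and y: "y \<in> set_pmf (?N \<omega>)"
    then have H: "H \<in> set_pmf (sbm n p q)" "G' \<in> set_pmf (Pi_pmf {1..K} {} (\<lambda>_. random_subset H (\<lambda>_. s)))"
      and r: "rigid n H" and wm: "well_matched K n d G' (\<lambda>_. id)"
      unfolding \<omega> parent_children_def by auto
    from y obtain \<pi> where \<pi>: "\<pi> \<in> set_pmf (Pi_pmf {2..K} id (\<lambda>_. ?R))"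
      and y: "y = (\<lambda>i. if i = 1 then G' 1 else relabel (\<pi> i) (G' i), \<pi>)" unfolding \<omega> by auto
    have setR: "set_pmf ?R = {\<rho>. \<rho> permutes {1..n}}"
      using permutes_id[of "{1..n}"] finite_permutations[of "{1..n}"] by (intro set_pmf_of_set) blast+
    have \<pi>': "\<pi> \<in> PiE_dflt {2..K} id (\<lambda>_. {\<rho>. \<rho> permutes {1..n}})"
      using \<pi> unfolding set_Pi_pmf[OF finite_atLeastAtMost] o_def setR .
    \<comment> \<open>Index 1 lies outside \<open>{2..K}\<close> and takes the default value
      \<open>id\<close>, so the unrelabelled first graph fits the same formula as the
      others.\<close>
    have \<pi>1: "\<pi> 1 = id" using \<pi>' by (simp add: PiE_dflt_def)
    have perm: "\<pi> i permutes {1..n}" if "i \<in> {1..K}" for i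
    proof (cases "i = 1")
      case True
      then show ?thesis using \<pi>1 permutes_id by metis
    next
      case False
      then have "i \<in> {2..K}" using that by auto
      then show ?thesis using \<pi>' unfolding PiE_dflt_def by blast
    qed
    have Hv: "H \<subseteq> vertex_pairs n" by (rule sbm_subset[OF H(1)])
    have sub: "G' i \<subseteq> H" if "i \<in> {1..K}" for i
    proof (rule random_subset_subset[OF finite_subset[OF Hv finite_vertex_pairs]])
      show "G' i \<in> set_pmf (random_subset H (\<lambda>_. s))"
        using H(2) that unfolding set_Pi_pmf[OF finite_atLeastAtMost] PiE_dflt_def o_def by blast
    qed
    have rel: "(\<lambda>i. if i = 1 then G' 1 else relabel (\<pi> i) (G' i)) i = relabel (\<pi> i) (G' i)" for i
      using \<pi>1 by (simp add: relabel_def)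
    show "y \<in> {(G, \<pi>). \<forall>i\<in>{2..K}. matcher K d n G i = \<pi> i}"
      using matcher_eq[OF perm \<pi>1 rel sub Hv r wm d] unfolding y by simp
  qed
qed

lemma one_minus_power_le_exp:
  assumes "0 \<le> z" "z \<le> (1::real)"
  shows "(1 - z) ^ k \<le> exp (- (real k * z))"
proof -
  have "(1 - z) ^ k \<le> exp (- z) ^ k" using assms exp_ge_add_one_self[of "- z"] by (intro power_mono) auto
  also have "\<dots> = exp (- (real k * z))" by (simp add: exp_of_nat_mult[symmetric])
  finally show ?thesis .
qed

text \<open>Success can fail in two ways, a failed degree test and a parent that is not rigid; this
  is the resulting explicit bound at fixed \<open>n\<close>.\<close>

lemma prob_matcher_bound:
  assumes d: "13 * K\<^sup>2 < d" and s: "0 \<le> s" "s \<le> 1" and x: "0 < x" "x \<le> 1"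
    and pq: "0 \<le> p" "p \<le> P" "0 \<le> q" "q \<le> P" "P \<le> 1"
    and small: "exp 1 * real n ^ 3 * P ^ 4 \<le> 1 / 2"
  shows "1 - real n * 2 ^ K * ((1 / x) ^ d * exp (- (real (n - 1) * ((p + q) / 2 * ((1 - x) * (s * (1 - (1 - s) ^ (K - 1))))))))
           - 2 * (exp 1 * real n ^ 3 * P ^ 4)
    \<le> measure_pmf.prob (csbm K n p q s) {(G, \<pi>). \<forall>i\<in>{2..K}. matcher K d n G i = \<pi> i}"
proof -
  define z where "z = (p + q) / 2 * ((1 - x) * (s * (1 - (1 - s) ^ (K - 1))))"
  let ?pc = "parent_children K n p q s"
  let ?W = "{(G, G'). \<not> well_matched K n d G' (\<lambda>_. id)} :: (graph \<times> (nat \<Rightarrow> graph)) set"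
  let ?R = "{(G, G'). \<not> rigid n G} :: (graph \<times> (nat \<Rightarrow> graph)) set"
  have z: "0 \<le> z" "z \<le> 1" unfolding z_def by (rule average_rate_bounds; use s x pq in simp)+
  have "measure_pmf.prob ?pc ?W \<le> real n * 2 ^ K * ((1 / x) ^ d * (1 - z) ^ (n - 1))"
    unfolding z_def by (rule prob_not_well_matched_le) (use s x pq in auto)
  also have "\<dots> \<le> real n * 2 ^ K * ((1 / x) ^ d * exp (- (real (n - 1) * z)))"
    using x one_minus_power_le_exp[OF z] by (intro mult_left_mono) auto
  finally have W: "measure_pmf.prob ?pc ?W \<le> real n * 2 ^ K * ((1 / x) ^ d * exp (- (real (n - 1) * z)))" .
  have "map_pmf fst ?pc = sbm n p q"
    unfolding parent_children_def by (simp add: map_bind_pmf bind_return_pmf')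
  then have "measure_pmf.prob ?pc ?R = measure_pmf.prob (sbm n p q) {G. \<not> rigid n G}"
    using measure_map_pmf[of fst ?pc "{G. \<not> rigid n G}"] by (simp add: vimage_def case_prod_beta')
  also have "\<dots> \<le> 2 * (exp 1 * real n ^ 3 * P ^ 4)"
    by (rule prob_sbm_not_rigid_le[OF pq small])
  finally have R: "measure_pmf.prob ?pc ?R \<le> 2 * (exp 1 * real n ^ 3 * P ^ 4)" .
  have "1 - measure_pmf.prob ?pc (?W \<union> ?R) = measure_pmf.prob ?pc (UNIV - (?W \<union> ?R))"
    using measure_pmf.prob_compl[of "?W \<union> ?R" ?pc] by simp
  also have "UNIV - (?W \<union> ?R) = {(G, G'). rigid n G \<and> well_matched K n d G' (\<lambda>_. id)}" by auto
  also have "measure_pmf.prob ?pc \<dots> \<le>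
      measure_pmf.prob (csbm K n p q s) {(G, \<pi>). \<forall>i\<in>{2..K}. matcher K d n G i = \<pi> i}"
    by (rule prob_matcher_ge[OF d])
  finally have "1 - measure_pmf.prob ?pc (?W \<union> ?R) \<le>
      measure_pmf.prob (csbm K n p q s) {(G, \<pi>). \<forall>i\<in>{2..K}. matcher K d n G i = \<pi> i}" .
  moreover have "measure_pmf.prob ?pc (?W \<union> ?R) \<le> measure_pmf.prob ?pc ?W + measure_pmf.prob ?pc ?R"
    by (rule measure_Un_le) simp_all
  ultimately show ?thesis using W R unfolding z_def by linarith
qed

theorem theorem3:
  fixes K :: nat and a b s :: real
  assumes "K \<ge> 2" and "a > 0" and "b > 0" and "0 \<le> s" and "s \<le> 1"
    and "s * (1 - (1 - s) ^ (K - 1)) * ((a + b) / 2) > 1"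
  shows "\<exists>est :: nat \<Rightarrow> (nat \<Rightarrow> graph) \<Rightarrow> nat \<Rightarrow> nat \<Rightarrow> nat.
    (\<forall>n. matching_estimator K n (est n)) \<and>
    (\<lambda>n. measure_pmf.prob (csbm K n (a * (ln (real n) / real n)) (b * (ln (real n) / real n)) s)
           {(G, \<pi>). \<forall>i\<in>{2..K}. est n G i = \<pi> i}) \<longlonglongrightarrow> 1"
proof -
  define d where "d = 13 * K\<^sup>2 + 1"
  define \<theta> where "\<theta> = s * (1 - (1 - s) ^ (K - 1))"
  define c where "c = \<theta> * ((a + b) / 2)"
  have c: "1 < c" using assms(6) by (simp add: c_def \<theta>_def)
  \<comment> \<open>With this choice \<open>(1 - x) * c = (c + 1) / 2\<close>, halfway between 1 and
    \<open>c\<close>, so the loss in the Chernoff bound keeps the rate above 1.\<close>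
  define x where "x = (1 - 1 / c) / 2"
  have x: "0 < x" "x \<le> 1" using c by (auto simp: x_def field_simps)
  define c' where "c' = (1 - x) * c"
  have c': "1 < c'" using c by (simp add: c'_def x_def field_simps)
  define M where "M = max a b"
  have M: "0 < M" "a \<le> M" "b \<le> M" using assms by (auto simp: M_def)
  define P where "P n = M * (ln (real n) / real n)" for n :: nat
  define C where "C = 2 ^ K * (1 / x) ^ d"
  let ?p = "\<lambda>n. a * (ln (real n) / real n)"
  let ?q = "\<lambda>n. b * (ln (real n) / real n)"
  let ?f = "\<lambda>n. measure_pmf.prob (csbm K n (?p n) (?q n) s)
           {(G, \<pi>). \<forall>i\<in>{2..K}. matcher K d n G i = \<pi> i}"
  let ?l = "\<lambda>n. 1 - C * (real n * exp (- ((real n - 1) * (c' * (ln (real n) / real n)))))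
      - 2 * (exp 1 * real n ^ 3 * (P n) ^ 4)"
  \<comment> \<open>Up to constants this is \<open>ln n ^ 4 / n\<close>.\<close>
  have P0: "(\<lambda>n. exp 1 * real n ^ 3 * (P n) ^ 4) \<longlonglongrightarrow> 0"
    unfolding P_def using M(1) by real_asymp
  have l: "?l \<longlonglongrightarrow> 1"
  proof -
    \<comment> \<open>This is of order \<open>n ^ (1 - c')\<close>, the point where the threshold
      condition enters.\<close>
    have "(\<lambda>n. real n * exp (- ((real n - 1) * (c' * (ln (real n) / real n))))) \<longlonglongrightarrow> 0"
      using c' by real_asymp
    then have "?l \<longlonglongrightarrow> 1 - C * 0 - 2 * 0" by (intro tendsto_intros P0)
    then show ?thesis by simp
  qed
  have "P \<longlonglongrightarrow> 0" unfolding P_def by real_asymp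
  then have "eventually (\<lambda>n. P n < 1) sequentially" by (rule order_tendstoD(2)) simp
  moreover have "eventually (\<lambda>n. exp 1 * real n ^ 3 * (P n) ^ 4 < 1 / 2) sequentially"
    by (rule order_tendstoD(2)[OF P0]) simp
  ultimately have "eventually (\<lambda>n. ?l n \<le> ?f n) sequentially"
    using eventually_ge_at_top[of 1]
  proof eventually_elim
    case (elim n)
    define r where "r = ln (real n) / real n"
    have r: "0 \<le> r" using elim(3) by (simp add: r_def)
    have bound: "1 - real n * 2 ^ K * ((1 / x) ^ d * exp (- (real (n - 1) * ((a * r + b * r) / 2 * ((1 - x) * (s * (1 - (1 - s) ^ (K - 1))))))))
           - 2 * (exp 1 * real n ^ 3 * (P n) ^ 4)
      \<le> measure_pmf.prob (csbm K n (a * r) (b * r) s) {(G, \<pi>). \<forall>i\<in>{2..K}. matcher K d n G i = \<pi> i}"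
    proof (rule prob_matcher_bound)
      show "a * r \<le> P n" "b * r \<le> P n" unfolding P_def r_def[symmetric] using M r by (auto intro: mult_right_mono)
    qed (use elim assms x r in \<open>auto simp: d_def\<close>)
    have rate: "(a * r + b * r) / 2 * ((1 - x) * (s * (1 - (1 - s) ^ (K - 1)))) = c' * r"
      unfolding c'_def c_def \<theta>_def by (simp add: field_simps)
    \<comment> \<open>Natural subtraction truncates at \<open>n = 0\<close>, which is excluded
      eventually.\<close>
    have "real (n - 1) = real n - 1" using elim(3) by simp
    then show ?case using bound unfolding rate unfolding r_def C_def by (simp add: mult_ac)
  qed
  then have "?f \<longlonglongrightarrow> 1"
    by (intro tendsto_sandwich[OF _ _ l tendsto_const[of 1]]) (auto intro: always_eventually)
  then show ?thesis
    using matching_estimator_matcher by (intro exI[of _ "\<lambda>n. matcher K d n"]) blast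
qed

end
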